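(* Let $T$ be a perfect binary tree of height $h>0$ with vertex set $\{x_1,\dots,x_n\}$, let $S=\mathbb K[x_1,\dots,x_n]$ be the polynomial ring over a field $\mathbb K$, and let $I\subseteq S$ be the edge ideal of $T$. Let $m\ge 0$ be an integer. Then: (1) If $h=3m$, then $\operatorname{depth}(S/I)=\dfrac{4\cdot 8^{m}+3}{7}$. (2) If $h=3m+1$, then $\operatorname{depth}(S/I)=\dfrac{8^{m+1}-1}{7}$. (3) If $h=3m+2$, then $\operatorname{depth}(S/I)=\dfrac{2(8^{m+1}-1)}{7}$.
   Context: A perfect binary tree is a rooted tree in which every non-leaf vertex has exactly two children and all leaves lie at the same distance (number of edges) from the root; this common distance is the height $h$ of the tree. It is regarded as a finite simple graph. For a finite simple graph $G$ with vertices $x_1,\dots,x_n$ (identified with the variables of $S$), the edge ideal is $I(G)=(x_ix_j : \{x_i,x_j\}\in E(G))\subseteq S$. The depth of a nonzero finitely generated graded $S$-module $M$ is taken with respect to the maximal homogeneous ideal $\mathfrak m=(x_1,\dots,x_n)$: $\operatorname{depth}(M)=\min\{i : H^i_{\mathfrak m}(M)\ne 0\}$, where $H^i_{\mathfrak m}$ denotes local cohomology. *)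

theory Defs
  imports Complex_Main "HOL-Algebra.Module" "HOL-Algebra.QuotRing" "HOL-Algebra.Product_Groups"
    "HOL-Library.Poly_Mapping"
begin

text \<open>Edges are two-element sets of vertices.  (The notion \<open>tree\<close> for digraphs in the AFP entry
  Graph Theory is unsuitable: there a pair of opposite arcs already forms a cycle.)\<close>

definition simple_graph :: "'v set \<Rightarrow> 'v set set \<Rightarrow> bool" where
  "simple_graph V E \<longleftrightarrow> finite V \<and> (\<forall>e\<in>E. e \<subseteq> V \<and> card e = 2)"

definition walk :: "'v set \<Rightarrow> 'v set set \<Rightarrow> 'v list \<Rightarrow> bool" where
  "walk V E p \<longleftrightarrow> p \<noteq> [] \<and> set p \<subseteq> V \<and> successively (\<lambda>u v. {u, v} \<in> E) p"

definition connected_graph :: "'v set \<Rightarrow> 'v set set \<Rightarrow> bool" where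
  "connected_graph V E \<longleftrightarrow>
     V \<noteq> {} \<and> (\<forall>u\<in>V. \<forall>v\<in>V. \<exists>p. walk V E p \<and> hd p = u \<and> last p = v)"

definition graph_cycle :: "'v set \<Rightarrow> 'v set set \<Rightarrow> 'v list \<Rightarrow> bool" where
  "graph_cycle V E p \<longleftrightarrow> walk V E p \<and> distinct p \<and> 3 \<le> length p \<and> {last p, hd p} \<in> E"

definition tree :: "'v set \<Rightarrow> 'v set set \<Rightarrow> bool" where
  "tree V E \<longleftrightarrow> simple_graph V E \<and> connected_graph V E \<and> (\<nexists>p. graph_cycle V E p)"

definition graph_dist :: "'v set \<Rightarrow> 'v set set \<Rightarrow> 'v \<Rightarrow> 'v \<Rightarrow> nat" where
  "graph_dist V E u v =
     (LEAST k. \<exists>p. walk V E p \<and> hd p = u \<and> last p = v \<and> length p = Suc k)"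

definition children :: "'v set \<Rightarrow> 'v set set \<Rightarrow> 'v \<Rightarrow> 'v \<Rightarrow> 'v set" where
  "children V E r v = {w \<in> V. {v, w} \<in> E \<and> graph_dist V E r w = Suc (graph_dist V E r v)}"

definition perfect_binary_tree :: "'v set \<Rightarrow> 'v set set \<Rightarrow> nat \<Rightarrow> bool" where
  "perfect_binary_tree V E h \<longleftrightarrow> tree V E \<and>
     (\<exists>r\<in>V. \<forall>v\<in>V.
        (children V E r v \<noteq> {} \<longrightarrow> card (children V E r v) = 2) \<and>
        (children V E r v = {} \<longrightarrow> graph_dist V E r v = h))"

text \<open>\<open>'v \<Rightarrow>\<^sub>0 nat\<close> is the type of monomials (exponent vectors); \<open>poly_ring V\<close> is the ring of
  polynomials over \<open>'k\<close> in the variables \<open>mvar v\<close> with \<open>v \<in> V\<close>.\<close>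

definition poly_ring :: "'v set \<Rightarrow> (('v \<Rightarrow>\<^sub>0 nat) \<Rightarrow>\<^sub>0 'k::field) ring" where
  "poly_ring V =
     \<lparr>carrier = {p. \<forall>t \<in> Poly_Mapping.keys p. Poly_Mapping.keys t \<subseteq> V},
      mult = (*), one = 1, zero = 0, add = (+)\<rparr>"

definition mvar :: "'v \<Rightarrow> (('v \<Rightarrow>\<^sub>0 nat) \<Rightarrow>\<^sub>0 'k::field)" where
  "mvar v = Poly_Mapping.single (Poly_Mapping.single v 1) 1"

definition edge_ideal :: "'v set \<Rightarrow> 'v set set \<Rightarrow> (('v \<Rightarrow>\<^sub>0 nat) \<Rightarrow>\<^sub>0 'k::field) set" where
  "edge_ideal V E = Idl\<^bsub>poly_ring V\<^esub> {mvar u * mvar v | u v. {u, v} \<in> E}"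

definition quotient_module :: "('a, 'b) ring_scheme \<Rightarrow> 'a set \<Rightarrow> ('a, 'a set) module" where
  "quotient_module R I =
     \<lparr>carrier = carrier (R Quot I), mult = mult (R Quot I), one = one (R Quot I),
      zero = zero (R Quot I), add = add (R Quot I),
      smult = (\<lambda>a X. \<Union>x\<in>X. I +>\<^bsub>R\<^esub> (a \<otimes>\<^bsub>R\<^esub> x))\<rparr>"

text \<open>The class of \<open>(x, k)\<close> is the fraction \<open>x / f\<^sup>k\<close> in \<open>M\<^sub>f\<close>; two fractions \<open>x / f\<^sup>k\<close> and
  \<open>y / f\<^sup>l\<close> are equal iff \<open>f\<^sup>t (f\<^sup>l x - f\<^sup>k y) = 0\<close> for some \<open>t\<close>.\<close>

definition loc_rel ::
  "('a, 'b) ring_scheme \<Rightarrow> ('a, 'm, 'c) module_scheme \<Rightarrow> 'a \<Rightarrow> (('m \<times> nat) \<times> ('m \<times> nat)) set" where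
  "loc_rel R M f = {((x, k), (y, l)). x \<in> carrier M \<and> y \<in> carrier M \<and>
     (\<exists>t::nat. (f [^]\<^bsub>R\<^esub> t) \<odot>\<^bsub>M\<^esub> (((f [^]\<^bsub>R\<^esub> l) \<odot>\<^bsub>M\<^esub> x) \<ominus>\<^bsub>M\<^esub> ((f [^]\<^bsub>R\<^esub> k) \<odot>\<^bsub>M\<^esub> y)) = \<zero>\<^bsub>M\<^esub>)}"

definition loc_frac ::
  "('a, 'b) ring_scheme \<Rightarrow> ('a, 'm, 'c) module_scheme \<Rightarrow> 'a \<Rightarrow> 'm \<Rightarrow> nat \<Rightarrow> ('m \<times> nat) set" where
  "loc_frac R M f x k = loc_rel R M f `` {(x, k)}"

text \<open>Module records contain the ring fields \<open>mult\<close> and \<open>one\<close>, which play no role for a module.\<close>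

definition localization ::
  "('a, 'b) ring_scheme \<Rightarrow> ('a, 'm, 'c) module_scheme \<Rightarrow> 'a \<Rightarrow> ('a, ('m \<times> nat) set) module" where
  "localization R M f =
     \<lparr>carrier = (carrier M \<times> UNIV) // loc_rel R M f,
      mult = undefined, one = undefined,
      zero = loc_frac R M f \<zero>\<^bsub>M\<^esub> 0,
      add = (\<lambda>X Y. \<Union>(x, k)\<in>X. \<Union>(y, l)\<in>Y.
        loc_frac R M f (((f [^]\<^bsub>R\<^esub> l) \<odot>\<^bsub>M\<^esub> x) \<oplus>\<^bsub>M\<^esub> ((f [^]\<^bsub>R\<^esub> k) \<odot>\<^bsub>M\<^esub> y)) (k + l)),
      smult = (\<lambda>a X. \<Union>(x, k)\<in>X. loc_frac R M f (a \<odot>\<^bsub>M\<^esub> x) k)\<rparr>"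

text \<open>The canonical map from the localization at \<open>f\<close> to the localization at \<open>f g\<close>:
  \<open>x / f\<^sup>k = g\<^sup>k x / (f g)\<^sup>k\<close>.\<close>

definition loc_map ::
  "('a, 'b) ring_scheme \<Rightarrow> ('a, 'm, 'c) module_scheme \<Rightarrow> 'a \<Rightarrow> 'a \<Rightarrow> ('m \<times> nat) set \<Rightarrow> ('m \<times> nat) set" where
  "loc_map R M f g X = (\<Union>(x, k)\<in>X. loc_frac R M (f \<otimes>\<^bsub>R\<^esub> g) ((g [^]\<^bsub>R\<^esub> k) \<odot>\<^bsub>M\<^esub> x) k)"

text \<open>For a finite family \<open>x\<^sub>a\<close> (\<open>a \<in> A\<close>) of elements of a (Noetherian) commutative ring \<open>R\<close>, the local
  cohomology of an \<open>R\<close>-module \<open>M\<close> with support in the ideal generated by the family is the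
  cohomology of the Cech complex
  \<open>0 \<rightarrow> M \<rightarrow> \<Oplus>\<^sub>a M\<^bsub>x\<^sub>a\<^esub> \<rightarrow> \<Oplus>\<^bsub>a<b\<^esub> M\<^bsub>x\<^sub>a x\<^sub>b\<^esub> \<rightarrow> \<dots>\<close>
  whose term in degree \<open>i\<close> is the direct sum of the localizations of \<open>M\<close> at the products
  \<open>\<Prod>\<^bsub>a\<in>F\<^esub> x\<^sub>a\<close>, where \<open>F\<close> runs through the \<open>i\<close>-element subsets of \<open>A\<close>.  Cochains and cohomology
  are written multiplicatively, as \<open>product_group\<close> and \<open>Mod\<close> are operations on monoid records.\<close>

definition cech_cochains ::
  "('a, 'b) ring_scheme \<Rightarrow> ('i \<Rightarrow> 'a) \<Rightarrow> 'i set \<Rightarrow> ('a, 'm, 'c) module_scheme \<Rightarrow> nat \<Rightarrow>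
     ('i set \<Rightarrow> ('m \<times> nat) set) monoid" where
  "cech_cochains R x A M i =
     product_group {F. F \<subseteq> A \<and> card F = i}
       (\<lambda>F. add_monoid (localization R M (finprod R x F)))"

text \<open>The component at \<open>G\<close> of the differential is the alternating sum of the images of the
  components at \<open>G - {a}\<close>, the sign being determined by the position of \<open>a\<close> in \<open>G\<close>.\<close>

definition cech_diff ::
  "('a, 'b) ring_scheme \<Rightarrow> ('i::linorder \<Rightarrow> 'a) \<Rightarrow> 'i set \<Rightarrow> ('a, 'm, 'c) module_scheme \<Rightarrow> nat \<Rightarrow>
     ('i set \<Rightarrow> ('m \<times> nat) set) \<Rightarrow> 'i set \<Rightarrow> ('m \<times> nat) set" where
  "cech_diff R x A M i c =
     (\<lambda>G \<in> {G. G \<subseteq> A \<and> card G = Suc i}.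
        let L = localization R M (finprod R x G) in
        \<Oplus>\<^bsub>L\<^esub>a\<in>G.
          (let y = loc_map R M (finprod R x (G - {a})) (x a) (c (G - {a}))
           in if even (card {b \<in> G. b < a}) then y else \<ominus>\<^bsub>L\<^esub> y))"

definition cech_cocycles ::
  "('a, 'b) ring_scheme \<Rightarrow> ('i::linorder \<Rightarrow> 'a) \<Rightarrow> 'i set \<Rightarrow> ('a, 'm, 'c) module_scheme \<Rightarrow> nat \<Rightarrow>
     ('i set \<Rightarrow> ('m \<times> nat) set) set" where
  "cech_cocycles R x A M i =
     kernel (cech_cochains R x A M i) (cech_cochains R x A M (Suc i)) (cech_diff R x A M i)"

definition cech_coboundaries ::
  "('a, 'b) ring_scheme \<Rightarrow> ('i::linorder \<Rightarrow> 'a) \<Rightarrow> 'i set \<Rightarrow> ('a, 'm, 'c) module_scheme \<Rightarrow> nat \<Rightarrow>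
     ('i set \<Rightarrow> ('m \<times> nat) set) set" where
  "cech_coboundaries R x A M i =
     (case i of
        0 \<Rightarrow> {\<one>\<^bsub>cech_cochains R x A M 0\<^esub>}
      | Suc j \<Rightarrow> cech_diff R x A M j ` carrier (cech_cochains R x A M j))"

definition local_cohomology ::
  "('a, 'b) ring_scheme \<Rightarrow> ('i::linorder \<Rightarrow> 'a) \<Rightarrow> 'i set \<Rightarrow> ('a, 'm, 'c) module_scheme \<Rightarrow> nat \<Rightarrow>
     ('i set \<Rightarrow> ('m \<times> nat) set) set monoid" where
  "local_cohomology R x A M i =
     (cech_cochains R x A M i)\<lparr>carrier := cech_cocycles R x A M i\<rparr> Mod cech_coboundaries R x A M i"

text \<open>Depth with respect to the ideal generated by the family.  The minimum exists whenever \<open>M\<close> is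
  a nonzero finitely generated graded module over \<open>K[x\<^sub>1, \<dots>, x\<^sub>n]\<close> and the family is \<open>x\<^sub>1, \<dots>, x\<^sub>n\<close>.\<close>

definition depth ::
  "('a, 'b) ring_scheme \<Rightarrow> ('i::linorder \<Rightarrow> 'a) \<Rightarrow> 'i set \<Rightarrow> ('a, 'm, 'c) module_scheme \<Rightarrow> nat" where
  "depth R x A M =
     (LEAST i. carrier (local_cohomology R x A M i) \<noteq> {\<one>\<^bsub>local_cohomology R x A M i\<^esub>})"

end

theory Submission
  imports Defs
begin

text \<open>
  The edge ideal \<open>I\<close> of a forest satisfies: \<open>depth (S/I)\<close> is the least size of a maximal independent
  set (\<open>depth_edge_ideal_forest\<close>). The proposition follows by computing this number for a perfect
  binary tree.

  The Cech complex of \<open>S/I\<close> is graded by Laurent exponents. The edge ideal consists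
  of the polynomials all of whose monomials have dependent support, so \<open>x\<^sup>a\<close> with an integer
  exponent vector \<open>a\<close> survives in the localization at the variables of \<open>F\<close> exactly if the negative
  part of \<open>a\<close> lies in \<open>F\<close> and \<open>F\<close> together with the support of \<open>a\<close> is independent. In degree \<open>a\<close> the
  complex is therefore the cochain complex of the family of all such \<open>F\<close>, with the differential of
  simplicial cohomology.

  \<^item> If \<open>a\<close> has a positive entry at \<open>w\<close>, the vertex \<open>w\<close> can be added to and removed from the members
    of the family, which is thus a cone and acyclic (\<open>acyclic_at_cone\<close>).
  \<^item> Otherwise the family consists of the independent sets \<open>F\<close> above the support \<open>N\<close> of \<open>a\<close>. A forest
    has a vertex \<open>u\<close> with at most one neighbour \<open>v\<close> among the vertices that can still be added to \<open>N\<close>.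
    Without such a \<open>v\<close> the family is a cone over \<open>u\<close>; otherwise the members avoiding \<open>v\<close> form a cone
    over \<open>u\<close>, and the members containing \<open>v\<close> are the independent sets above \<open>insert v N\<close>. So the
    cohomology is that of a smaller family with the same cardinalities, and the recursion ends at a
    single maximal independent set. Hence there is no cohomology below the least size of such a set
    (\<open>acyclic_at_independent_sets\<close>).
  \<^item> Conversely, for every maximal independent set \<open>A\<close> the fraction \<open>1 / (\<Prod>v\<in>A. x\<^sub>v)\<close> is a cocycle in
    degree \<open>card A\<close>, because adding a variable kills it; it is no coboundary, because the fractions
    on smaller sets do not have all variables of \<open>A\<close> in the denominator
    (\<open>cocycles_not_subset_coboundaries\<close>).

  In a perfect binary tree of height \<open>h\<close>, the vertices on the levels \<open>h - 1, h - 4, h - 7, \<dots>\<close>, together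
  with the root if \<open>3\<close> divides \<open>h\<close>, form a maximal independent set. It has least size,
  since a maximal independent set meets every closed neighbourhood and the vertices of this set have
  disjoint closed neighbourhoods attached to them: that of a child for the vertices on the listed
  levels, and its own for a root that has been added (\<open>card_maximal_independent_ge\<close>). The three formulas are the resulting geometric sums.
\<close>

section \<open>Cochains on families of finite sets\<close>

definition incidence_sign :: "'i::linorder \<Rightarrow> 'i set \<Rightarrow> 'k::comm_ring_1" where
  "incidence_sign v H = (if even (card {b \<in> H. b < v}) then 1 else - 1)"

definition coboundary :: "('i::linorder set \<Rightarrow> 'k::comm_ring_1) \<Rightarrow> 'i set \<Rightarrow> 'k" where
  "coboundary c H = (\<Sum>v\<in>H. incidence_sign v H * c (H - {v}))"

lemma incidence_sign_square: "incidence_sign v H * (incidence_sign v H * x) = (x :: 'k::comm_ring_1)"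
  by (simp add: incidence_sign_def)

lemma incidence_sign_remove_less:
  assumes "finite H" "u \<in> H" "u < v"
  shows "incidence_sign v (H - {u}) = - incidence_sign v H"
proof -
  have "{b \<in> H. b < v} = insert u {b \<in> H - {u}. b < v}" using assms by auto
  then have "card {b \<in> H. b < v} = Suc (card {b \<in> H - {u}. b < v})" using assms(1) by simp
  then show ?thesis by (simp add: incidence_sign_def)
qed

lemma incidence_sign_remove_greater:
  assumes "v \<le> u"
  shows "incidence_sign v (H - {u}) = incidence_sign v H"
proof -
  have "{b \<in> H. b < v} = {b \<in> H - {u}. b < v}" using assms by auto
  then show ?thesis by (simp add: incidence_sign_def)
qed

lemma incidence_sign_swap:
  assumes "finite H" "u \<in> H" "v \<in> H" "u \<noteq> v"
  shows "incidence_sign v H * incidence_sign u (H - {v}) =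
         - (incidence_sign u H * incidence_sign v (H - {u}) :: 'k::comm_ring_1)"
proof (cases "u < v")
  case True
  then show ?thesis
    using assms by (simp add: incidence_sign_remove_less incidence_sign_remove_greater mult.commute)
next
  case False
  then have "v < u" using assms by simp
  then show ?thesis
    using assms by (simp add: incidence_sign_remove_less incidence_sign_remove_greater mult.commute)
qed

text \<open>
  The terms for \<open>(v, u)\<close> and \<open>(u, v)\<close> in the double sum cancel. The sum is split into the pairs with
  \<open>v < u\<close> and those with \<open>u < v\<close>, because comparing it with its own negative would not be enough in
  characteristic 2.
\<close>
lemma coboundary_coboundary:
  fixes c :: "'i::linorder set \<Rightarrow> 'k::comm_ring_1"
  assumes "finite H"
  shows "coboundary (coboundary c) H = 0"
proof -
  define T where "T = (\<lambda>(v, u). incidence_sign v H * incidence_sign u (H - {v}) * c (H - {v} - {u}))"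
  define P where "P = {(v, u). v \<in> H \<and> u \<in> H \<and> v < u}"
  define Q where "Q = {(v, u). v \<in> H \<and> u \<in> H \<and> u < v}"
  have fin: "finite P" "finite Q"
    using assms by (auto simp: P_def Q_def intro: finite_subset[of _ "H \<times> H"])
  have PQ: "Sigma H (\<lambda>v. H - {v}) = P \<union> Q" "P \<inter> Q = {}"
    by (auto simp: P_def Q_def)
  have "coboundary (coboundary c) H = (\<Sum>v\<in>H. \<Sum>u\<in>H - {v}. T (v, u))"
    by (simp add: coboundary_def T_def sum_distrib_left mult.assoc)
  also have "\<dots> = sum T (Sigma H (\<lambda>v. H - {v}))"
    using assms by (subst sum.Sigma) (auto simp: case_prod_beta')
  also have "\<dots> = sum T P + sum T Q"
    unfolding PQ using fin PQ by (intro sum.union_disjoint)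
  also have "sum T Q = (\<Sum>x\<in>P. - T x)"
  proof (rule sum.reindex_bij_witness[of _ prod.swap prod.swap])
    fix x assume "x \<in> Q"
    then obtain v u where x: "x = (v, u)" "v \<in> H" "u \<in> H" "u < v" by (auto simp: Q_def)
    have "H - {u} - {v} = H - {v} - {u}" by auto
    with x assms incidence_sign_swap[of H u v, where 'k = 'k]
    show "- T (prod.swap x) = T x" by (simp add: T_def)
  qed (auto simp: P_def Q_def)
  also have "sum T P + (\<Sum>x\<in>P. - T x) = 0" by (simp add: sum_negf)
  finally show ?thesis .
qed

definition supported_on :: "'i set set \<Rightarrow> ('i set \<Rightarrow> 'k::zero) \<Rightarrow> bool" where
  "supported_on \<Delta> c \<longleftrightarrow> (\<forall>F. c F \<noteq> 0 \<longrightarrow> F \<in> \<Delta>)"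

text \<open>
  The cochain complex of the family \<open>\<Delta>\<close> consists of the functions supported on \<open>\<Delta>\<close>, with the values of
  the coboundary outside \<open>\<Delta>\<close> discarded, and a set of cardinality \<open>i\<close> has degree \<open>i\<close>. Acyclicity in
  degree 0 says that a cocycle vanishes on the empty set, as the coboundary there is an empty sum.
\<close>
definition acyclic_at :: "'k::comm_ring_1 itself \<Rightarrow> 'i::linorder set set \<Rightarrow> nat \<Rightarrow> bool" where
  "acyclic_at _ \<Delta> i \<longleftrightarrow> (\<forall>c :: 'i set \<Rightarrow> 'k.
     supported_on \<Delta> c \<and> (\<forall>H\<in>\<Delta>. card H = Suc i \<longrightarrow> coboundary c H = 0) \<longrightarrow>
     (\<exists>b. supported_on \<Delta> b \<and> (\<forall>F\<in>\<Delta>. card F = i \<longrightarrow> coboundary b F = c F)))"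

lemma acyclic_atE:
  fixes c :: "'i::linorder set \<Rightarrow> 'k::comm_ring_1"
  assumes "acyclic_at TYPE('k) \<Delta> i" "supported_on \<Delta> c"
    and "\<And>H. H \<in> \<Delta> \<Longrightarrow> card H = Suc i \<Longrightarrow> coboundary c H = 0"
  obtains b where "supported_on \<Delta> b" "\<And>F. F \<in> \<Delta> \<Longrightarrow> card F = i \<Longrightarrow> coboundary b F = c F"
  using assms by (force simp: acyclic_at_def)

text \<open>
  Contraction with \<open>w\<close>, which sends a cochain \<open>c\<close> to \<open>F \<mapsto> \<plusminus> c (insert w F)\<close> on the sets without \<open>w\<close>,
  is a null-homotopy of the identity.
\<close>
lemma acyclic_at_cone:
  fixes \<Delta> :: "'i::linorder set set"
  assumes fin: "\<And>F. F \<in> \<Delta> \<Longrightarrow> finite F"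
    and ins: "\<And>F. F \<in> \<Delta> \<Longrightarrow> insert w F \<in> \<Delta>"
    and del: "\<And>F. F \<in> \<Delta> \<Longrightarrow> F - {w} \<in> \<Delta>"
  shows "acyclic_at TYPE('k::comm_ring_1) \<Delta> i"
  unfolding acyclic_at_def
proof (intro allI impI, elim conjE)
  fix c :: "'i set \<Rightarrow> 'k"
  assume supp: "supported_on \<Delta> c"
    and cyc: "\<forall>H\<in>\<Delta>. card H = Suc i \<longrightarrow> coboundary c H = 0"
  define b where "b F = (if w \<in> F then 0 else incidence_sign w (insert w F) * c (insert w F))" for F
  have "supported_on \<Delta> b"
    unfolding supported_on_def
  proof (intro allI impI)
    fix F assume "b F \<noteq> 0"
    then have "w \<notin> F" "c (insert w F) \<noteq> 0" by (auto simp: b_def split: if_splits)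
    then have "insert w F \<in> \<Delta>" using supp by (auto simp: supported_on_def)
    from del[OF this] show "F \<in> \<Delta>" using \<open>w \<notin> F\<close> by simp
  qed
  moreover have "coboundary b F = c F" if F: "F \<in> \<Delta>" "card F = i" for F
  proof (cases "w \<in> F")
    case True
    have "coboundary b F = (\<Sum>v\<in>F. if v = w then incidence_sign w F * b (F - {w}) else 0)"
      unfolding coboundary_def using True by (intro sum.cong) (auto simp: b_def)
    also have "\<dots> = incidence_sign w F * b (F - {w})"
      using fin[OF F(1)] True by simp
    also have "\<dots> = c F"
      using True by (simp add: b_def insert_absorb incidence_sign_square)
    finally show ?thesis .
  next
    case False
    define H where "H = insert w F"
    have finF: "finite F" using fin F by blast
    have "coboundary c H = 0"
      using cyc ins F False finF by (simp add: H_def)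
    then have 0: "incidence_sign w H * c F + (\<Sum>v\<in>F. incidence_sign v H * c (H - {v})) = 0"
      using False finF by (simp add: coboundary_def H_def)
    have "coboundary b F = (\<Sum>v\<in>F. - (incidence_sign w H * (incidence_sign v H * c (H - {v}))))"
      unfolding coboundary_def
    proof (intro sum.cong refl)
      fix v assume v: "v \<in> F"
      have H': "insert w (F - {v}) = H - {v}" "H - {w} = F" using v False by (auto simp: H_def)
      have "incidence_sign v H * incidence_sign w (H - {v}) =
            - (incidence_sign w H * incidence_sign v F :: 'k)"
        using incidence_sign_swap[of H w v, where 'k = 'k] v False finF H'(2)
        by (auto simp: H_def)
      then have "incidence_sign v F * (incidence_sign v H * (incidence_sign v H * incidence_sign w (H - {v}))) =
            - (incidence_sign v F * (incidence_sign v F * (incidence_sign w H * incidence_sign v H :: 'k)))"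
        by (simp add: ac_simps)
      then have "incidence_sign v F * incidence_sign w (H - {v}) =
            - (incidence_sign w H * incidence_sign v H :: 'k)"
        by (simp only: incidence_sign_square)
      then show "incidence_sign v F * b (F - {v}) =
            - (incidence_sign w H * (incidence_sign v H * c (H - {v})))"
        using False H'(1) by (simp add: b_def mult.assoc[symmetric])
    qed
    also have "\<dots> = - incidence_sign w H * (\<Sum>v\<in>F. incidence_sign v H * c (H - {v}))"
      by (simp add: sum_negf sum_distrib_left)
    also have "\<dots> = incidence_sign w H * (incidence_sign w H * c F)"
      using 0 by (simp add: eq_neg_iff_add_eq_0[symmetric])
    finally show ?thesis by (simp add: incidence_sign_square)
  qed
  ultimately show "\<exists>b. supported_on \<Delta> b \<and> (\<forall>F\<in>\<Delta>. card F = i \<longrightarrow> coboundary b F = c F)" by blast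
qed

text \<open>
  The cochains supported on the sets containing \<open>v\<close> form a subcomplex, and the quotient is the complex
  of the sets avoiding \<open>v\<close>; acyclicity of both passes to the whole complex as in a long exact sequence.
  Convexity of \<open>\<Delta>\<close> is what makes the restricted coboundary square to zero.
\<close>
lemma acyclic_at_split:
  fixes \<Delta> :: "'i::linorder set set"
  assumes fin: "\<And>F. F \<in> \<Delta> \<Longrightarrow> finite F"
    and convex: "\<And>F G H. F \<in> \<Delta> \<Longrightarrow> H \<in> \<Delta> \<Longrightarrow> F \<subseteq> G \<Longrightarrow> G \<subseteq> H \<Longrightarrow> G \<in> \<Delta>"
    and without: "acyclic_at TYPE('k::comm_ring_1) {F \<in> \<Delta>. v \<notin> F} i"
    and "with": "acyclic_at TYPE('k) {F \<in> \<Delta>. v \<in> F} i"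
  shows "acyclic_at TYPE('k) \<Delta> i"
  unfolding acyclic_at_def
proof (intro allI impI, elim conjE)
  fix c :: "'i set \<Rightarrow> 'k"
  assume supp: "supported_on \<Delta> c"
    and cyc: "\<forall>H\<in>\<Delta>. card H = Suc i \<longrightarrow> coboundary c H = 0"
  define c0 where "c0 F = (if v \<in> F then 0 else c F)" for F
  have supp0: "supported_on {F \<in> \<Delta>. v \<notin> F} c0"
    using supp by (auto simp: supported_on_def c0_def)
  have cyc0: "coboundary c0 H = 0" if "H \<in> {F \<in> \<Delta>. v \<notin> F}" "card H = Suc i" for H
  proof -
    have "coboundary c0 H = coboundary c H"
      using that by (simp add: coboundary_def c0_def)
    then show ?thesis using that cyc by simp
  qed
  obtain b0 where b0: "supported_on {F \<in> \<Delta>. v \<notin> F} b0"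
      "\<And>F. F \<in> {F \<in> \<Delta>. v \<notin> F} \<Longrightarrow> card F = i \<Longrightarrow> coboundary b0 F = c0 F"
    using acyclic_atE[OF without supp0 cyc0] by blast
  \<comment> \<open>In degree \<open>i\<close> the cocycle \<open>c\<close> is corrected by \<open>b0\<close> to one that vanishes on the sets avoiding \<open>v\<close>.\<close>
  define c1 where "c1 F = (if F \<in> \<Delta> \<and> v \<in> F \<and> card F = i then c F - coboundary b0 F else 0)" for F
  have supp1: "supported_on {F \<in> \<Delta>. v \<in> F} c1"
    by (auto simp: supported_on_def c1_def)
  have cyc1: "coboundary c1 H = 0" if H: "H \<in> {F \<in> \<Delta>. v \<in> F}" "card H = Suc i" for H
  proof -
    have "coboundary c1 H = (\<Sum>x\<in>H. incidence_sign x H * (c (H - {x}) - coboundary b0 (H - {x})))"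
      unfolding coboundary_def[of c1]
    proof (intro sum.cong refl arg_cong2[where f = "(*)"])
      fix x assume x: "x \<in> H"
      have card: "card (H - {x}) = i" using H x fin by simp
      show "c1 (H - {x}) = c (H - {x}) - coboundary b0 (H - {x})"
      proof (cases "H - {x} \<in> \<Delta>")
        case True
        then show ?thesis using b0(2)[of "H - {x}"] card by (auto simp: c1_def c0_def)
      next
        case False
        have "b0 (H - {x} - {y}) = 0" for y
        proof (rule ccontr)
          assume "b0 (H - {x} - {y}) \<noteq> 0"
          then have "H - {x} - {y} \<in> \<Delta>" using b0(1) by (auto simp: supported_on_def)
          then show False using convex[of "H - {x} - {y}" H "H - {x}"] H(1) False by blast
        qed
        then have "coboundary b0 (H - {x}) = 0" by (simp add: coboundary_def)
        moreover have "c (H - {x}) = 0" using supp False by (auto simp: supported_on_def)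
        ultimately show ?thesis using False by (simp add: c1_def)
      qed
    qed
    also have "\<dots> = coboundary c H - coboundary (coboundary b0) H"
      by (simp add: coboundary_def[of _ H] right_diff_distrib sum_subtractf)
    also have "\<dots> = 0" using cyc H fin by (simp add: coboundary_coboundary)
    finally show ?thesis .
  qed
  obtain b1 where b1: "supported_on {F \<in> \<Delta>. v \<in> F} b1"
      "\<And>F. F \<in> {F \<in> \<Delta>. v \<in> F} \<Longrightarrow> card F = i \<Longrightarrow> coboundary b1 F = c1 F"
    using acyclic_atE[OF "with" supp1 cyc1] by blast
  have "supported_on \<Delta> (\<lambda>F. b0 F + b1 F)"
    unfolding supported_on_def
  proof (intro allI impI)
    fix F assume "b0 F + b1 F \<noteq> 0"
    then have "b0 F \<noteq> 0 \<or> b1 F \<noteq> 0" by auto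
    then show "F \<in> \<Delta>" using b0(1) b1(1) by (auto simp: supported_on_def)
  qed
  moreover have "coboundary (\<lambda>F. b0 F + b1 F) F = c F" if F: "F \<in> \<Delta>" "card F = i" for F
  proof -
    have sum: "coboundary (\<lambda>F. b0 F + b1 F) F = coboundary b0 F + coboundary b1 F"
      by (simp add: coboundary_def distrib_left sum.distrib)
    show ?thesis
    proof (cases "v \<in> F")
      case True
      then show ?thesis using sum b1(2)[of F] F True by (simp add: c1_def)
    next
      case False
      then have "b1 (F - {x}) = 0" for x using b1(1) by (auto simp: supported_on_def)
      then show ?thesis using sum b0(2)[of F] F False
        by (simp add: c0_def coboundary_def[of b1])
    qed
  qed
  ultimately show "\<exists>b. supported_on \<Delta> b \<and> (\<forall>F\<in>\<Delta>. card F = i \<longrightarrow> coboundary b F = c F)" by blast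
qed

section \<open>Independent sets of forests\<close>

definition independent_set :: "'v set set \<Rightarrow> 'v set \<Rightarrow> bool" where
  "independent_set E F \<longleftrightarrow> (\<forall>u\<in>F. \<forall>v\<in>F. {u, v} \<notin> E)"

definition maximal_independent_set :: "'v set \<Rightarrow> 'v set set \<Rightarrow> 'v set \<Rightarrow> bool" where
  "maximal_independent_set V E F \<longleftrightarrow> F \<subseteq> V \<and> independent_set E F \<and>
     (\<forall>w\<in>V - F. \<not> independent_set E (insert w F))"

lemma independent_set_subset:
  "independent_set E G \<Longrightarrow> F \<subseteq> G \<Longrightarrow> independent_set E F"
  by (auto simp: independent_set_def)

lemma independent_set_insert:
  assumes "simple_graph V E" "independent_set E F" "\<And>x. x \<in> F \<Longrightarrow> {w, x} \<notin> E"
  shows "independent_set E (insert w F)"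
proof -
  have "{w, w} \<notin> E" using assms(1) by (auto simp: simple_graph_def)
  then show ?thesis
    using assms(2,3) by (auto simp: independent_set_def insert_commute)
qed

text \<open>
  An end \<open>u\<close> of a longest path in \<open>W\<close> has all its neighbours in \<open>W\<close> on the path, and a neighbour beyond
  the second vertex would close a cycle.
\<close>
lemma no_cycle_imp_leaf:
  assumes sg: "simple_graph V E" and nc: "\<nexists>p. graph_cycle V E p"
    and W: "W \<subseteq> V" "W \<noteq> {}"
  obtains u where "u \<in> W" "\<And>x y. x \<in> W \<Longrightarrow> y \<in> W \<Longrightarrow> {u, x} \<in> E \<Longrightarrow> {u, y} \<in> E \<Longrightarrow> x = y"
proof -
  have finW: "finite W" using sg W finite_subset by (auto simp: simple_graph_def)
  define P where "P p \<longleftrightarrow> walk V E p \<and> set p \<subseteq> W \<and> distinct p" for p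
  obtain w where w: "w \<in> W" using W by blast
  then have "P [w]" using W by (auto simp: P_def walk_def)
  moreover have "\<forall>p. P p \<longrightarrow> length p < Suc (card W)"
    using finW by (auto simp: P_def less_Suc_eq_le distinct_card[symmetric] intro: card_mono)
  ultimately obtain p where p: "P p" "\<And>q. P q \<Longrightarrow> length q \<le> length p"
    using ex_has_greatest_nat[of P "[w]" length "Suc (card W)"] by (metis less_imp_le)
  obtain u q where pq: "p = u # q" using p(1) by (cases p) (auto simp: P_def walk_def)
  have on_q: "x \<in> set q" if x: "x \<in> W" "{u, x} \<in> E" for x
  proof (rule ccontr)
    assume "x \<notin> set q"
    moreover have "x \<noteq> u" using x sg by (auto simp: simple_graph_def)
    ultimately have "P (x # p)"
      using p(1) x W pq by (auto simp: P_def walk_def insert_commute)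
    then show False using p(2) by fastforce
  qed
  have hd_q: "x = hd q" if x: "x \<in> W" "{u, x} \<in> E" for x
  proof (rule ccontr)
    assume "x \<noteq> hd q"
    obtain ys zs where q: "q = ys @ x # zs" using on_q[OF x] by (meson split_list)
    then have "ys \<noteq> []" using \<open>x \<noteq> hd q\<close> by auto
    define r where "r = u # ys @ [x]"
    have "p = r @ zs" by (simp add: r_def pq q)
    then have "successively (\<lambda>u v. {u, v} \<in> E) (r @ zs)" "set r \<subseteq> V" "distinct r"
      using p(1) by (auto simp: P_def walk_def)
    then have "walk V E r" "distinct r"
      by (simp_all only: walk_def successively_append_iff) (simp_all add: r_def)
    moreover have "3 \<le> length r" using \<open>ys \<noteq> []\<close> by (cases ys) (auto simp: r_def)
    moreover have "{last r, hd r} \<in> E" using x by (simp add: r_def insert_commute)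
    ultimately have "graph_cycle V E r" by (simp add: graph_cycle_def)
    then show False using nc by blast
  qed
  show thesis
  proof
    show "u \<in> W" using p(1) pq by (auto simp: P_def)
    show "x = y" if "x \<in> W" "y \<in> W" "{u, x} \<in> E" "{u, y} \<in> E" for x y
      using hd_q that by metis
  qed
qed

text \<open>
  Let \<open>W\<close> consist of the vertices that can be added to \<open>N\<close>. If \<open>W\<close> is empty, \<open>N\<close> is a maximal
  independent set and too large to have a superset of cardinality \<open>i\<close>. Otherwise choose a vertex \<open>u\<close> with
  at most one neighbour in \<open>W\<close>. If there is none, the family is a cone over \<open>u\<close>. If \<open>v\<close> is the neighbour,
  the sets avoiding \<open>v\<close> form a cone over \<open>u\<close>, and those containing \<open>v\<close> are covered by the induction
  hypothesis for \<open>insert v N\<close>. The bound \<open>i\<close> does not change in the induction because degrees are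
  cardinalities of whole sets and not of their differences with \<open>N\<close>.
\<close>
lemma acyclic_at_independent_sets:
  fixes V :: "'v::linorder set"
  assumes sg: "simple_graph V E" and nc: "\<nexists>p. graph_cycle V E p"
    and d: "\<And>F. maximal_independent_set V E F \<Longrightarrow> i < card F"
    and N: "N \<subseteq> V" "independent_set E N"
  shows "acyclic_at TYPE('k::comm_ring_1) {F. N \<subseteq> F \<and> F \<subseteq> V \<and> independent_set E F} i"
  using N
proof (induction "card (V - N)" arbitrary: N rule: less_induct)
  case less
  define \<Delta> where "\<Delta> = {F. N \<subseteq> F \<and> F \<subseteq> V \<and> independent_set E F}"
  define W where "W = {w \<in> V - N. independent_set E (insert w N)}"
  have finV: "finite V" using sg by (simp add: simple_graph_def)
  have fin: "finite F" if "F \<in> \<Delta>" for F using that finV finite_subset by (auto simp: \<Delta>_def)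
  have in_W: "x \<in> W" if "F \<in> \<Delta>" "x \<in> F" "x \<notin> N" for F x
    using that by (auto simp: \<Delta>_def W_def intro: independent_set_subset)
  have cone: "insert u F \<in> \<Delta>" if u: "u \<in> W" and F: "F \<in> \<Delta>"
      and nb: "\<And>x. x \<in> F \<Longrightarrow> x \<in> W \<Longrightarrow> {u, x} \<notin> E" for u F
  proof -
    have "{u, x} \<notin> E" if "x \<in> F" for x
      using u nb[OF that] in_W[OF F that] by (auto simp: W_def independent_set_def)
    then have "independent_set E (insert u F)"
      using F sg by (intro independent_set_insert) (auto simp: \<Delta>_def)
    then show ?thesis using F u by (auto simp: \<Delta>_def W_def)
  qed
  have del: "F - {u} \<in> \<Delta>" if "u \<in> W" "F \<in> \<Delta>" for u F
    using that by (auto simp: \<Delta>_def W_def intro: independent_set_subset)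
  have "acyclic_at TYPE('k) \<Delta> i"
  proof (cases "W = {}")
    case True
    then have "maximal_independent_set V E N"
      using less.prems by (auto simp: W_def maximal_independent_set_def)
    then have "i < card N" by (rule d)
    moreover have "card N \<le> card F" if "F \<in> \<Delta>" for F
      using that fin by (auto simp: \<Delta>_def intro: card_mono)
    ultimately have "card F \<noteq> i" if "F \<in> \<Delta>" for F using that by fastforce
    then show ?thesis by (auto simp: acyclic_at_def supported_on_def intro: exI[of _ "\<lambda>_. 0"])
  next
    case False
    have "W \<subseteq> V" by (auto simp: W_def)
    from no_cycle_imp_leaf[OF sg nc this False]
    obtain u where u: "u \<in> W" "\<And>x y. x \<in> W \<Longrightarrow> y \<in> W \<Longrightarrow> {u, x} \<in> E \<Longrightarrow> {u, y} \<in> E \<Longrightarrow> x = y"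
      by blast
    show ?thesis
    proof (cases "\<exists>v\<in>W. {u, v} \<in> E")
      case False
      then show ?thesis
        using fin cone[OF u(1)] del[OF u(1)] by (intro acyclic_at_cone[where w = u]) auto
    next
      case True
      then obtain v where v: "v \<in> W" "{u, v} \<in> E" by blast
      have "u \<noteq> v" using v sg by (auto simp: simple_graph_def)
      show ?thesis
      proof (rule acyclic_at_split[where v = v])
        show "acyclic_at TYPE('k) {F \<in> \<Delta>. v \<notin> F} i"
        proof (rule acyclic_at_cone[where w = u])
          show "insert u F \<in> {F \<in> \<Delta>. v \<notin> F}" if "F \<in> {F \<in> \<Delta>. v \<notin> F}" for F
            using that cone[OF u(1)] u(2) v \<open>u \<noteq> v\<close> by fastforce
        qed (use fin del[OF u(1)] in auto)
        have "card (V - insert v N) < card (V - N)"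
          using v finV by (intro psubset_card_mono) (auto simp: W_def)
        moreover have "{F \<in> \<Delta>. v \<in> F} = {F. insert v N \<subseteq> F \<and> F \<subseteq> V \<and> independent_set E F}"
          by (auto simp: \<Delta>_def)
        ultimately show "acyclic_at TYPE('k) {F \<in> \<Delta>. v \<in> F} i"
          using less.hyps[of "insert v N"] v less.prems by (auto simp: W_def)
      qed (use fin in \<open>auto simp: \<Delta>_def intro: independent_set_subset\<close>)
    qed
  qed
  then show ?case by (simp add: \<Delta>_def)
qed

section \<open>Perfect binary trees\<close>

lemma simple_path_of_rtrancl:
  assumes "(x, y) \<in> {(a, b). a \<in> U \<and> b \<in> U \<and> {a, b} \<in> E}\<^sup>*" "y \<in> U"
  shows "\<exists>p. walk U E p \<and> distinct p \<and> hd p = x \<and> last p = y"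
  using assms(1)
proof (induction rule: converse_rtrancl_induct)
  case base
  then show ?case using assms(2) by (intro exI[of _ "[y]"]) (auto simp: walk_def)
next
  case (step x z)
  then obtain p where p: "walk U E p" "distinct p" "hd p = z" "last p = y" by blast
  show ?case
  proof (cases "x \<in> set p")
    case False
    then have "walk U E (x # p)" using p step.hyps(1) by (cases p) (auto simp: walk_def)
    then show ?thesis using p False by (intro exI[of _ "x # p"]) (auto simp: walk_def)
  next
    case True
    then obtain ys zs where "p = ys @ x # zs" by (meson split_list)
    then have "walk U E (x # zs)" "distinct (x # zs)" "last (x # zs) = y"
      using p by (auto simp: walk_def successively_append_iff)
    then show ?thesis by (intro exI[of _ "x # zs"]) auto
  qed
qed

lemma residues_mod_3:
  fixes k c :: nat
  shows "(k + 1) mod 3 \<noteq> c mod 3 \<Longrightarrow> k mod 3 \<noteq> c mod 3 \<Longrightarrow> (k + 2) mod 3 = c mod 3"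
    and "(k + 1) mod 3 = c mod 3 \<Longrightarrow> k mod 3 \<noteq> c mod 3"
    and "(k + 1) mod 3 = c mod 3 \<Longrightarrow> (k + 2) mod 3 \<noteq> c mod 3"
proof -
  have "(k + 1) mod 3 = (k mod 3 + 1) mod 3" "(k + 2) mod 3 = (k mod 3 + 2) mod 3"
    by (rule mod_add_left_eq[symmetric])+
  moreover have "k mod 3 \<in> {0, 1, 2}" "c mod 3 \<in> {0, 1, 2}"
    using mod_less_divisor[of 3 k] mod_less_divisor[of 3 c] by (auto simp del: mod_less_divisor)
  moreover have "(x + 1) mod 3 \<noteq> y \<Longrightarrow> x \<noteq> y \<Longrightarrow> (x + 2) mod 3 = y"
      "(x + 1) mod 3 = y \<Longrightarrow> x \<noteq> y" "(x + 1) mod 3 = y \<Longrightarrow> (x + 2) mod 3 \<noteq> y"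
    if "x \<in> {0, 1, 2}" "y \<in> {0, 1, 2}" for x y :: nat
    using that by auto
  ultimately show "(k + 1) mod 3 \<noteq> c mod 3 \<Longrightarrow> k mod 3 \<noteq> c mod 3 \<Longrightarrow> (k + 2) mod 3 = c mod 3"
    and "(k + 1) mod 3 = c mod 3 \<Longrightarrow> k mod 3 \<noteq> c mod 3"
    and "(k + 1) mod 3 = c mod 3 \<Longrightarrow> (k + 2) mod 3 \<noteq> c mod 3"
    by metis+
qed

locale rooted_tree =
  fixes V :: "'v set" and E :: "'v set set" and r :: 'v
  assumes tree: "tree V E" and root: "r \<in> V"
begin

abbreviation level :: "'v \<Rightarrow> nat" where
  "level v \<equiv> graph_dist V E r v"

lemma simple: "simple_graph V E" and no_cycle: "\<nexists>p. graph_cycle V E p"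
  using tree by (auto simp: tree_def)

lemma finite_V: "finite V" and edge_fst: "{u, v} \<in> E \<Longrightarrow> u \<in> V"
  and edge_snd: "{u, v} \<in> E \<Longrightarrow> v \<in> V" and no_loop: "{v, v} \<notin> E"
  using simple by (auto simp: simple_graph_def)

lemma geodesic:
  assumes "v \<in> V"
  obtains p where "walk V E p" "hd p = r" "last p = v" "length p = Suc (level v)"
proof -
  obtain p where "walk V E p" "hd p = r" "last p = v"
    using tree root assms unfolding tree_def connected_graph_def by blast
  then have "\<exists>k p. walk V E p \<and> hd p = r \<and> last p = v \<and> length p = Suc k"
    by (intro exI[of _ "length p - 1"] exI[of _ p]) (auto simp: walk_def)
  from LeastI_ex[OF this] show thesis
    using that unfolding graph_dist_def by blast
qed

lemma level_le_walk:
  "walk V E p \<Longrightarrow> hd p = r \<Longrightarrow> last p = v \<Longrightarrow> length p = Suc k \<Longrightarrow> level v \<le> k"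
  unfolding graph_dist_def by (rule Least_le) blast

lemma level_edge_le:
  assumes "{u, v} \<in> E"
  shows "level v \<le> Suc (level u)"
proof -
  have uv: "u \<in> V" "v \<in> V" using assms edge_fst edge_snd by (auto simp: insert_commute)
  obtain p where p: "walk V E p" "hd p = r" "last p = u" "length p = Suc (level u)"
    using geodesic[OF uv(1)] by blast
  then have "walk V E (p @ [v])"
    using uv assms by (auto simp: walk_def successively_append_iff)
  moreover have "hd (p @ [v]) = r" using p by (auto simp: walk_def)
  ultimately show ?thesis using p(4) by (intro level_le_walk[of "p @ [v]"]) auto
qed

lemma level_root [simp]: "level r = 0"
  using level_le_walk[of "[r]" r 0] root by (auto simp: walk_def)

lemma level_0_iff: "v \<in> V \<Longrightarrow> level v = 0 \<longleftrightarrow> v = r"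
proof
  assume v: "v \<in> V" "level v = 0"
  obtain p where p: "hd p = r" "last p = v" "length p = Suc 0"
    using geodesic[OF v(1)] v(2) by metis
  then show "v = r" by (cases p) auto
qed auto

lemma ex_lower_neighbour:
  assumes "v \<in> V" "level v = Suc k"
  obtains u where "{u, v} \<in> E" "level u = k"
proof -
  obtain p where p: "walk V E p" "hd p = r" "last p = v" "length p = Suc (Suc k)"
    using geodesic[OF assms(1)] assms(2) by metis
  then have "p = butlast p @ [v]" by (metis append_butlast_last_id walk_def)
  then obtain q where q: "p = q @ [v]" by blast
  then have lq: "length q = Suc k" "q \<noteq> []" using p by auto
  then have w: "walk V E q" "{last q, v} \<in> E" "hd q = r"
    using p q by (auto simp: walk_def successively_append_iff)
  then have "level (last q) \<le> k" using level_le_walk[of q "last q" k] lq by auto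
  moreover have "Suc k \<le> Suc (level (last q))" using level_edge_le[OF w(2)] assms(2) by simp
  ultimately show thesis using that w(2) by auto
qed

text \<open>
  Levels decrease strictly along a geodesic to the root, so only its first vertex can have level at
  least that of \<open>v\<close>.
\<close>
lemma path_to_root_avoiding:
  assumes "w \<in> V" "w \<noteq> v" "level w \<le> level v"
  shows "(w, r) \<in> {(a, b). a \<in> V - {v} \<and> b \<in> V - {v} \<and> {a, b} \<in> E}\<^sup>*"
  using assms
proof (induction "level w" arbitrary: w)
  case 0
  then show ?case using level_0_iff by auto
next
  case (Suc k)
  obtain u where u: "{u, w} \<in> E" "level u = k"
    using ex_lower_neighbour Suc.hyps(2) Suc.prems(1) by metis
  then have "u \<in> V" "u \<noteq> v" using edge_fst edge_snd Suc by auto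
  then have "(u, r) \<in> {(a, b). a \<in> V - {v} \<and> b \<in> V - {v} \<and> {a, b} \<in> E}\<^sup>*"
    using Suc u by auto
  moreover have "(w, u) \<in> {(a, b). a \<in> V - {v} \<and> b \<in> V - {v} \<and> {a, b} \<in> E}"
    using u \<open>u \<in> V\<close> \<open>u \<noteq> v\<close> Suc.prems by (auto simp: insert_commute)
  ultimately show ?case by (rule converse_rtrancl_into_rtrancl[rotated])
qed

text \<open>
  Two such neighbours are joined through the root by a path that avoids \<open>v\<close>, and this path closes up
  to a cycle through \<open>v\<close>.
\<close>
lemma lower_neighbour_unique:
  assumes "{v, w} \<in> E" "{v, w'} \<in> E" "level w \<le> level v" "level w' \<le> level v"
  shows "w = w'"
proof (rule ccontr)
  assume "w \<noteq> w'"
  let ?R = "{(a, b). a \<in> V - {v} \<and> b \<in> V - {v} \<and> {a, b} \<in> E}"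
  have "w \<in> V" "w' \<in> V" "w \<noteq> v" "w' \<noteq> v" "v \<in> V"
    using assms edge_fst edge_snd no_loop
    by (auto simp: insert_commute)
  then have "(w, r) \<in> ?R\<^sup>*" "(w', r) \<in> ?R\<^sup>*"
    using path_to_root_avoiding assms by blast+
  moreover have "sym ?R" by (auto simp: sym_def insert_commute)
  ultimately have "(w, w') \<in> ?R\<^sup>*"
    by (meson rtrancl_trans sym_rtrancl symD)
  then obtain p where p: "walk (V - {v}) E p" "distinct p" "hd p = w" "last p = w'"
    using simple_path_of_rtrancl[of w w' "V - {v}" E] \<open>w' \<in> V\<close> \<open>w' \<noteq> v\<close> by blast
  have "2 \<le> length p"
  proof (rule ccontr)
    assume "\<not> 2 \<le> length p"
    then have "length p = 1" using p(1) by (cases p) (auto simp: walk_def not_le Suc_le_eq)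
    then show False using p \<open>w \<noteq> w'\<close> by (cases p) auto
  qed
  then have "graph_cycle V E (v # p)"
    using p assms \<open>v \<in> V\<close>
    by (cases p) (auto simp: graph_cycle_def walk_def insert_commute)
  then show False using no_cycle by blast
qed

lemma level_edge:
  assumes "{u, v} \<in> E"
  shows "level u = Suc (level v) \<or> level v = Suc (level u)"
proof -
  have *: "level v = Suc (level u)" if e: "{u, v} \<in> E" and le: "level u \<le> level v" for u v
  proof (rule ccontr)
    assume "level v \<noteq> Suc (level u)"
    then have eq: "level v = level u" using level_edge_le[OF e] le by simp
    have "u \<in> V" "v \<in> V" "u \<noteq> v" using e edge_fst edge_snd no_loop by (auto simp: insert_commute)
    then have "level v \<noteq> 0" using level_0_iff eq by metis
    then obtain k where k: "level v = Suc k" by (cases "level v") auto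
    obtain w where w: "{w, v} \<in> E" "level w = k" using ex_lower_neighbour[OF \<open>v \<in> V\<close> k] by blast
    then have "w = u" using lower_neighbour_unique[of v w u] e le k by (auto simp: insert_commute)
    then show False using w eq k by simp
  qed
  have "{v, u} \<in> E" using assms by (simp add: insert_commute)
  with assms show ?thesis using *[of u v] *[of v u] by linarith
qed

text \<open>
  The root is its own parent. This convention makes \<open>star_centre\<close> below send the root and its children
  to the root when \<open>3\<close> divides the height.
\<close>
definition parent :: "'v \<Rightarrow> 'v" where
  "parent v = (if v = r then r else SOME u. {u, v} \<in> E \<and> level v = Suc (level u))"

lemma mem_children: "w \<in> children V E r v \<longleftrightarrow> {v, w} \<in> E \<and> level w = Suc (level v)"
  using edge_fst edge_snd by (auto simp: children_def insert_commute)

lemma parent_children: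
  assumes "w \<in> children V E r v"
  shows "parent w = v"
proof -
  have w: "{v, w} \<in> E" "level w = Suc (level v)" using assms by (auto simp: mem_children)
  then have "w \<noteq> r" by auto
  then have "parent w = (SOME u. {u, w} \<in> E \<and> level w = Suc (level u))" by (simp add: parent_def)
  also have "\<dots> = v"
  proof (rule some_equality)
    fix u assume "{u, w} \<in> E \<and> level w = Suc (level u)"
    then have u: "{w, u} \<in> E" "level u \<le> level w" by (simp_all add: insert_commute)
    have "{w, v} \<in> E" "level v \<le> level w" using w by (simp_all add: insert_commute)
    with u show "u = v" using lower_neighbour_unique by blast
  qed (use w in simp)
  finally show ?thesis .
qed

lemma children_parent:
  assumes "v \<in> V" "v \<noteq> r"
  shows "v \<in> children V E r (parent v)"
proof -
  obtain k where k: "level v = Suc k" using assms level_0_iff by (cases "level v") auto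
  then obtain u where u: "{u, v} \<in> E" "level u = k" using ex_lower_neighbour assms by metis
  then have "v \<in> children V E r u" using k by (simp add: mem_children)
  then show ?thesis using parent_children by metis
qed

end

locale perfect_binary_rooted_tree = rooted_tree V E r
  for V :: "'v set" and E :: "'v set set" and r :: 'v +
  fixes h :: nat
  assumes card_children: "v \<in> V \<Longrightarrow> children V E r v \<noteq> {} \<Longrightarrow> card (children V E r v) = 2"
    and level_leaf: "v \<in> V \<Longrightarrow> children V E r v = {} \<Longrightarrow> level v = h"
begin

text \<open>
  A vertex of the greatest level has no children, so that level is \<open>h\<close>.
\<close>
lemma level_le: "v \<in> V \<Longrightarrow> level v \<le> h"
proof -
  assume v: "v \<in> V"
  define m where "m = Max (level ` V)"
  have "m \<in> level ` V" unfolding m_def using v finite_V by (intro Max_in) auto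
  then obtain w where w: "w \<in> V" "level w = m" by auto
  have le: "level x \<le> m" if "x \<in> V" for x unfolding m_def using that finite_V by auto
  have "children V E r w = {}"
  proof (rule ccontr)
    assume "children V E r w \<noteq> {}"
    then obtain x where x: "{w, x} \<in> E" "level x = Suc (level w)" by (auto simp: mem_children)
    then have "x \<in> V" using edge_fst edge_snd by (simp add: insert_commute)
    then show False using le[of x] x w by simp
  qed
  then have "m = h" using level_leaf w by auto
  then show "level v \<le> h" using le v by simp
qed

lemma ex_child: "v \<in> V \<Longrightarrow> level v < h \<Longrightarrow> \<exists>w. w \<in> children V E r v"
  using level_leaf by force

lemma card_level: "k \<le> h \<Longrightarrow> card {v \<in> V. level v = k} = 2 ^ k"
proof (induction k)
  case 0
  have "{v \<in> V. level v = 0} = {r}" using root level_0_iff by auto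
  then show ?case by simp
next
  case (Suc k)
  have eq: "{v \<in> V. level v = Suc k} = (\<Union>u\<in>{v \<in> V. level v = k}. children V E r u)"
  proof (intro equalityI subsetI)
    fix v assume v: "v \<in> {v \<in> V. level v = Suc k}"
    then have "v \<noteq> r" by auto
    then have c: "v \<in> children V E r (parent v)" using v children_parent by auto
    then have "parent v \<in> V" "level (parent v) = k"
      using v edge_fst edge_snd by (auto simp: mem_children)
    then show "v \<in> (\<Union>u\<in>{v \<in> V. level v = k}. children V E r u)" using c by auto
  next
    fix v assume "v \<in> (\<Union>u\<in>{v \<in> V. level v = k}. children V E r u)"
    then show "v \<in> {v \<in> V. level v = Suc k}" by (auto simp: children_def)
  qed
  have "card (\<Union>u\<in>{v \<in> V. level v = k}. children V E r u) =
        (\<Sum>u\<in>{v \<in> V. level v = k}. card (children V E r u))"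
  proof (rule card_UN_disjoint)
    show "\<forall>i\<in>{v \<in> V. level v = k}. \<forall>j\<in>{v \<in> V. level v = k}.
        i \<noteq> j \<longrightarrow> children V E r i \<inter> children V E r j = {}"
      by (auto dest: parent_children)
    show "\<forall>i\<in>{v \<in> V. level v = k}. finite (children V E r i)"
      using finite_V by (auto simp: children_def)
  qed (use finite_V in auto)
  also have "\<dots> = (\<Sum>u\<in>{v \<in> V. level v = k}. 2)"
  proof (rule sum.cong)
    fix u assume "u \<in> {v \<in> V. level v = k}"
    then have "u \<in> V" "level u < h" using Suc.prems by auto
    then show "card (children V E r u) = 2" using ex_child card_children by blast
  qed simp
  finally show ?case using Suc eq by simp
qed

text \<open>
  The levels are \<open>h - 1, h - 4, h - 7, \<dots>\<close>. Their vertices dominate all levels down to \<open>0\<close>, except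
  level \<open>0\<close> itself when the last listed level is \<open>2\<close>; then the root has to be added.
\<close>
definition sparse_levels :: "'v set" where
  "sparse_levels = {v \<in> V. (level v + 1) mod 3 = h mod 3} \<union> {v. v = r \<and> h mod 3 = 0}"

text \<open>
  If \<open>c\<close> is a child of a vertex \<open>p\<close> on one of the levels \<open>h - 1, h - 4, \<dots>\<close>, the closed neighbourhood of
  \<open>c\<close>, which consists of \<open>p\<close>, \<open>c\<close> and the children of \<open>c\<close>, is mapped to \<open>p\<close>.
\<close>
definition star_centre :: "'v \<Rightarrow> 'v" where
  "star_centre x = (if (level x + 1) mod 3 = h mod 3 then x
     else if level x mod 3 = h mod 3 then parent x else parent (parent x))"

text \<open>
  A vertex outside the set lies either one level below a listed level, where its parent is in the set,
  or one level above, where its children are.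
\<close>
lemma sparse_levels_maximal_independent: "maximal_independent_set V E sparse_levels"
  unfolding maximal_independent_set_def
proof (intro conjI ballI)
  show "sparse_levels \<subseteq> V" unfolding sparse_levels_def using root by blast
  have no_edge: False if uv: "u \<in> sparse_levels" "v \<in> sparse_levels" "{u, v} \<in> E"
      and l: "level v = Suc (level u)" for u v
  proof -
    have "v \<noteq> r" using l by auto
    then have v: "(level u + 2) mod 3 = h mod 3" using uv l by (auto simp: sparse_levels_def)
    have "(level u + 1) mod 3 = h mod 3 \<or> u = r \<and> h mod 3 = 0"
      using uv unfolding sparse_levels_def by blast
    then show False
    proof
      assume "(level u + 1) mod 3 = h mod 3"
      then show False using residues_mod_3(3) v by blast
    next
      assume "u = r \<and> h mod 3 = 0"
      then show False using v by simp
    qed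
  qed
  show "independent_set E sparse_levels"
    unfolding independent_set_def using no_edge level_edge by (metis insert_commute)
next
  fix w assume w: "w \<in> V - sparse_levels"
  have "\<exists>x\<in>sparse_levels. {w, x} \<in> E"
  proof (cases "level w mod 3 = h mod 3")
    case True
    then have "w \<noteq> r" using w by (auto simp: sparse_levels_def)
    then have "w \<in> children V E r (parent w)" using w children_parent by auto
    then have "{parent w, w} \<in> E" "level w = Suc (level (parent w))" by (auto simp: mem_children)
    moreover from this have "parent w \<in> sparse_levels"
      using True edge_fst edge_snd by (auto simp: sparse_levels_def)
    ultimately show ?thesis by (auto simp: insert_commute)
  next
    case False
    then have "level w < h" using w level_le[of w] by (metis DiffD1 nat_less_le)
    then obtain c where c: "c \<in> children V E r w" using ex_child w by blast
    have "(level w + 1) mod 3 \<noteq> h mod 3" using w by (auto simp: sparse_levels_def)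
    with False have "(level w + 2) mod 3 = h mod 3" by (intro residues_mod_3(1))
    then have "c \<in> sparse_levels" using c by (auto simp: sparse_levels_def children_def)
    then show ?thesis using c by (auto simp: mem_children)
  qed
  then show "\<not> independent_set E (insert w sparse_levels)"
    by (auto simp: independent_set_def)
qed

text \<open>
  Maximality means that \<open>F\<close> meets every closed neighbourhood. Every \<open>p\<close> in \<open>sparse_levels\<close> has a closed
  neighbourhood on which \<open>star_centre\<close> takes the constant value \<open>p\<close>: that of a child of \<open>p\<close>, or that of
  the root if \<open>p\<close> is the root and does not lie on a listed level. Hence \<open>star_centre\<close> maps \<open>F\<close> onto
  \<open>sparse_levels\<close>.
\<close>
lemma card_maximal_independent_ge:
  assumes F: "maximal_independent_set V E F"
  shows "card sparse_levels \<le> card F"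
proof (rule surj_card_le)
  have FV: "F \<subseteq> V" using F by (simp add: maximal_independent_set_def)
  then show "finite F" using finite_V finite_subset by blast
  have dominated: "\<exists>x\<in>F. x = c \<or> {c, x} \<in> E" if "c \<in> V" for c
  proof (rule ccontr)
    assume a: "\<not> (\<exists>x\<in>F. x = c \<or> {c, x} \<in> E)"
    then have "independent_set E (insert c F)"
      using F simple by (intro independent_set_insert) (auto simp: maximal_independent_set_def)
    then show False using F that a by (auto simp: maximal_independent_set_def)
  qed
  show "sparse_levels \<subseteq> star_centre ` F"
  proof
    fix p assume p: "p \<in> sparse_levels"
    show "p \<in> star_centre ` F"
    proof (cases "(level p + 1) mod 3 = h mod 3")
      case True
      then have pV: "p \<in> V" using p root by (auto simp: sparse_levels_def)
      have next_levels: "level p mod 3 \<noteq> h mod 3" "(level p + 2) mod 3 \<noteq> h mod 3"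
        using residues_mod_3(2,3) True by blast+
      then have "level p \<noteq> h" by auto
      then have "level p < h" using level_le[OF pV] by simp
      then obtain c where c: "c \<in> children V E r p" using ex_child pV by blast
      then have c': "c \<in> V" "level c = Suc (level p)" "parent c = p"
        using parent_children by (auto simp: children_def)
      obtain x where x: "x \<in> F" "x = c \<or> {c, x} \<in> E" using dominated c' by blast
      have "star_centre x = p"
      proof (cases "x = c")
        case eq: True
        have "level x = level p + 1" "level x + 1 = level p + 2" using eq c' by simp_all
        then have "(level x + 1) mod 3 \<noteq> h mod 3" "level x mod 3 = h mod 3"
          using next_levels True by (simp_all only: not_False_eq_True)
        then show ?thesis using c' eq unfolding star_centre_def by simp
      next
        case False
        then have e: "{c, x} \<in> E" using x by simp
        show ?thesis
        proof (cases "level x = Suc (level c)")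
          case lx: True
          then have "parent x = c" using e by (intro parent_children) (simp add: mem_children)
          have "level x = level p + 2" "level x + 1 = level p + 3" using lx c' by simp_all
          then have "(level x + 1) mod 3 \<noteq> h mod 3" "level x mod 3 \<noteq> h mod 3"
            using next_levels by (simp_all only: mod_add_self2 not_False_eq_True)
          then show ?thesis using c' \<open>parent x = c\<close> unfolding star_centre_def by simp
        next
          case lx: False
          then have "level c = Suc (level x)" using level_edge[OF e] by auto
          then have "c \<in> children V E r x" using e by (simp add: mem_children insert_commute)
          then have "x = p" using parent_children c' by auto
          then show ?thesis using True by (simp add: star_centre_def)
        qed
      qed
      then show ?thesis using x by blast
    next
      case False
      then have "p = r" "h mod 3 = 0" using p by (auto simp: sparse_levels_def)
      obtain x where x: "x \<in> F" "x = r \<or> {r, x} \<in> E" using dominated root by blast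
      have "star_centre x = r"
      proof (cases "x = r")
        case True
        then show ?thesis using \<open>h mod 3 = 0\<close> by (simp add: star_centre_def parent_def)
      next
        case False
        then have e: "{r, x} \<in> E" using x by simp
        then have "level x = 1" using level_edge[OF e] by auto
        moreover from this have "parent x = r"
          using e by (intro parent_children) (simp add: mem_children)
        ultimately show ?thesis using \<open>h mod 3 = 0\<close> by (simp add: star_centre_def parent_def)
      qed
      then show ?thesis using x(1) \<open>p = r\<close> by (intro image_eqI[of _ _ x]) simp_all
    qed
  qed
qed

lemma card_levels:
  "card {v \<in> V. P (level v)} = (\<Sum>k | k \<le> h \<and> P k. 2 ^ k)"
proof -
  let ?K = "{k. k \<le> h \<and> P k}"
  have "{v \<in> V. P (level v)} = (\<Union>k\<in>?K. {v \<in> V. level v = k})" using level_le by auto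
  also have "card \<dots> = (\<Sum>k\<in>?K. card {v \<in> V. level v = k})"
    using finite_V by (intro card_UN_disjoint) auto
  also have "\<dots> = (\<Sum>k\<in>?K. 2 ^ k)" by (intro sum.cong) (auto simp: card_level)
  finally show ?thesis .
qed

lemma card_sparse_levels:
  "card sparse_levels = (\<Sum>k | k \<le> h \<and> (k + 1) mod 3 = h mod 3. 2 ^ k) + (if h mod 3 = 0 then 1 else 0)"
proof -
  let ?L = "{v \<in> V. (level v + 1) mod 3 = h mod 3}"
  have L: "card ?L = (\<Sum>k | k \<le> h \<and> (k + 1) mod 3 = h mod 3. 2 ^ k)"
    by (rule card_levels)
  show ?thesis
  proof (cases "h mod 3 = 0")
    case True
    then have "sparse_levels = insert r ?L" "r \<notin> ?L" by (auto simp: sparse_levels_def)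
    then show ?thesis using L True finite_V by simp
  next
    case False
    then have "sparse_levels = ?L" unfolding sparse_levels_def by blast
    then show ?thesis using L False by simp
  qed
qed

end

lemma sum_powers_of_8: "7 * (\<Sum>i<m. 8 ^ i :: nat) + 1 = 8 ^ m"
  by (induction m) auto

lemma sum_every_third_power:
  assumes "\<And>k. k \<in> K \<longleftrightarrow> (\<exists>i<m. k = 3 * i + c)"
  shows "7 * (\<Sum>k\<in>K. 2 ^ k :: nat) + 2 ^ c = 2 ^ c * 8 ^ m"
proof -
  have "K = (\<lambda>i. 3 * i + c) ` {..<m}" using assms by auto
  then have "(\<Sum>k\<in>K. 2 ^ k :: nat) = (\<Sum>i<m. 2 ^ (3 * i + c))"
    by (simp add: sum.reindex inj_on_def)
  also have "\<dots> = 2 ^ c * (\<Sum>i<m. 8 ^ i)"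
  proof -
    have "2 ^ (3 * i + c) = 2 ^ c * (8 ^ i :: nat)" for i by (simp add: power_add power_mult[of 2 3])
    then show ?thesis by (simp only: sum_distrib_left)
  qed
  finally show ?thesis
    using arg_cong[OF sum_powers_of_8[of m], of "\<lambda>x. 2 ^ c * x"] by (simp add: algebra_simps)
qed

context perfect_binary_rooted_tree
begin

lemma card_sparse_levels_0:
  assumes h: "h = 3 * m"
  shows "7 * card sparse_levels = 4 * 8 ^ m + 3"
proof -
  have mod: "h mod 3 = 0" unfolding h by presburger
  have "k \<in> {k. k \<le> h \<and> (k + 1) mod 3 = h mod 3} \<longleftrightarrow> (\<exists>i<m. k = 3 * i + 2)" for k
  proof -
    have "k \<le> 3 * m \<and> (k + 1) mod 3 = 0 \<longleftrightarrow> (\<exists>i<m. k = 3 * i + 2)"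
      by presburger
    then show ?thesis unfolding mod by (simp add: h)
  qed
  from sum_every_third_power[OF this] show ?thesis
    unfolding card_sparse_levels using mod by simp
qed

lemma card_sparse_levels_1:
  assumes h: "h = 3 * m + 1"
  shows "7 * card sparse_levels + 1 = 8 ^ (m + 1)"
proof -
  have mod: "h mod 3 = 1" unfolding h by presburger
  have "k \<in> {k. k \<le> h \<and> (k + 1) mod 3 = h mod 3} \<longleftrightarrow> (\<exists>i<m + 1. k = 3 * i + 0)" for k
  proof -
    have "k \<le> 3 * m + 1 \<and> (k + 1) mod 3 = 1 \<longleftrightarrow> (\<exists>i<m + 1. k = 3 * i + 0)"
      by presburger
    then show ?thesis unfolding mod by (simp add: h)
  qed
  from sum_every_third_power[OF this] show ?thesis
    unfolding card_sparse_levels using mod by simp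
qed

lemma card_sparse_levels_2:
  assumes h: "h = 3 * m + 2"
  shows "7 * card sparse_levels + 2 = 2 * 8 ^ (m + 1)"
proof -
  have mod: "h mod 3 = 2" unfolding h by presburger
  have "k \<in> {k. k \<le> h \<and> (k + 1) mod 3 = h mod 3} \<longleftrightarrow> (\<exists>i<m + 1. k = 3 * i + 1)" for k
  proof -
    have "k \<le> 3 * m + 2 \<and> (k + 1) mod 3 = 2 \<longleftrightarrow> (\<exists>i<m + 1. k = 3 * i + 1)"
      by presburger
    then show ?thesis unfolding mod by (simp add: h)
  qed
  from sum_every_third_power[OF this] show ?thesis
    unfolding card_sparse_levels using mod by simp
qed

end

section \<open>Polynomial rings, edge ideals and Laurent polynomials\<close>

lemma lookup_single_mult:
  fixes g :: "'a::cancel_comm_monoid_add \<Rightarrow>\<^sub>0 'k::comm_semiring_1"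
  shows "Poly_Mapping.lookup (Poly_Mapping.single s c * g) (s + t) = c * Poly_Mapping.lookup g t"
    and "(\<And>t. k \<noteq> s + t) \<Longrightarrow> Poly_Mapping.lookup (Poly_Mapping.single s c * g) k = 0"
proof -
  have *: "Poly_Mapping.lookup (Poly_Mapping.single s c * g) k =
        c * (\<Sum>q. Poly_Mapping.lookup g q when k = s + q)" for k
    by (simp add: lookup_mult lookup_single when_mult)
  show "Poly_Mapping.lookup (Poly_Mapping.single s c * g) (s + t) = c * Poly_Mapping.lookup g t"
    by (simp add: *)
  show "(\<And>t. k \<noteq> s + t) \<Longrightarrow> Poly_Mapping.lookup (Poly_Mapping.single s c * g) k = 0"
    by (simp add: *)
qed

lemma sum_single: "(\<Sum>t\<in>Poly_Mapping.keys p. Poly_Mapping.single t (Poly_Mapping.lookup p t)) = p"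
  by (rule poly_mapping_eqI)
    (auto simp: lookup_sum lookup_single when_def in_keys_iff)

lemma poly_ring_simps [simp]:
  "mult (poly_ring V) = (*)" "one (poly_ring V) = 1" "zero (poly_ring V) = 0" "add (poly_ring V) = (+)"
  by (simp_all add: poly_ring_def)

lemma mem_poly_ring:
  "p \<in> carrier (poly_ring V) \<longleftrightarrow> (\<forall>t\<in>Poly_Mapping.keys p. Poly_Mapping.keys t \<subseteq> V)"
  by (simp add: poly_ring_def)

lemma keys_add_nat: "Poly_Mapping.keys (s + t :: 'v \<Rightarrow>\<^sub>0 nat) = Poly_Mapping.keys s \<union> Poly_Mapping.keys t"
  by (auto simp: in_keys_iff lookup_add)

lemma cring_poly_ring: "cring (poly_ring V :: (('v \<Rightarrow>\<^sub>0 nat) \<Rightarrow>\<^sub>0 'k::field) ring)"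
proof (rule cringI)
  show "abelian_group (poly_ring V :: (('v \<Rightarrow>\<^sub>0 nat) \<Rightarrow>\<^sub>0 'k::field) ring)"
  proof (rule abelian_groupI)
    fix x :: "('v \<Rightarrow>\<^sub>0 nat) \<Rightarrow>\<^sub>0 'k"
    assume "x \<in> carrier (poly_ring V)"
    then show "\<exists>y\<in>carrier (poly_ring V). y \<oplus>\<^bsub>poly_ring V\<^esub> x = \<zero>\<^bsub>poly_ring V\<^esub>"
      by (intro bexI[of _ "- x"]) (auto simp: mem_poly_ring in_keys_iff)
  qed (use keys_add in \<open>fastforce simp: mem_poly_ring algebra_simps\<close>)+
  show "Group.comm_monoid (poly_ring V :: (('v \<Rightarrow>\<^sub>0 nat) \<Rightarrow>\<^sub>0 'k::field) ring)"
  proof (rule comm_monoidI)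
    fix x y :: "('v \<Rightarrow>\<^sub>0 nat) \<Rightarrow>\<^sub>0 'k"
    assume "x \<in> carrier (poly_ring V)" "y \<in> carrier (poly_ring V)"
    then show "x \<otimes>\<^bsub>poly_ring V\<^esub> y \<in> carrier (poly_ring V)"
      using keys_mult[of x y] by (fastforce simp: mem_poly_ring keys_add_nat)
  qed (auto simp: mem_poly_ring algebra_simps)
qed (simp add: algebra_simps)

lemma nat_pow_poly_ring: "p [^]\<^bsub>poly_ring V\<^esub> (k::nat) = p ^ k"
proof -
  interpret cring "poly_ring V :: (('a \<Rightarrow>\<^sub>0 nat) \<Rightarrow>\<^sub>0 'b::field) ring" by (rule cring_poly_ring)
  show ?thesis by (induction k) (simp_all add: mult.commute)
qed

lemma a_inv_poly_ring:
  assumes "p \<in> carrier (poly_ring V)"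
  shows "\<ominus>\<^bsub>poly_ring V\<^esub> p = - p"
proof -
  interpret cring "poly_ring V :: (('a \<Rightarrow>\<^sub>0 nat) \<Rightarrow>\<^sub>0 'b::field) ring" by (rule cring_poly_ring)
  have "- p \<in> carrier (poly_ring V)" using assms by (auto simp: mem_poly_ring in_keys_iff)
  then show ?thesis using minus_equality[of "- p" p] assms by simp
qed

lemma a_minus_poly_ring:
  "q \<in> carrier (poly_ring V) \<Longrightarrow> p \<ominus>\<^bsub>poly_ring V\<^esub> q = p - q"
  by (simp add: a_minus_def a_inv_poly_ring)

lemma mvar_mult: "mvar u * mvar v = Poly_Mapping.single (Poly_Mapping.single u 1 + Poly_Mapping.single v 1) 1"
  by (simp add: mvar_def mult_single)

lemma not_independent_set_iff:
  "\<not> independent_set E F \<longleftrightarrow> (\<exists>u v. {u, v} \<in> E \<and> u \<in> F \<and> v \<in> F)"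
  by (auto simp: independent_set_def)

definition dependent_monomial_ideal ::
  "'v set \<Rightarrow> 'v set set \<Rightarrow> (('v \<Rightarrow>\<^sub>0 nat) \<Rightarrow>\<^sub>0 'k::field) set" where
  "dependent_monomial_ideal V E =
     {p \<in> carrier (poly_ring V). \<forall>t\<in>Poly_Mapping.keys p. \<not> independent_set E (Poly_Mapping.keys t)}"

lemma ideal_dependent_monomial_ideal:
  "ideal (dependent_monomial_ideal V E :: (('v \<Rightarrow>\<^sub>0 nat) \<Rightarrow>\<^sub>0 'k::field) set) (poly_ring V)"
proof -
  let ?R = "poly_ring V :: (('v \<Rightarrow>\<^sub>0 nat) \<Rightarrow>\<^sub>0 'k::field) ring"
  let ?J = "dependent_monomial_ideal V E :: (('v \<Rightarrow>\<^sub>0 nat) \<Rightarrow>\<^sub>0 'k::field) set"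
  interpret R: cring ?R by (rule cring_poly_ring)
  have mult: "x * a \<in> ?J" if "a \<in> ?J" "x \<in> carrier ?R" for a x
  proof -
    have "x * a \<in> carrier ?R"
      using that R.m_closed by (auto simp: dependent_monomial_ideal_def)
    moreover have "\<not> independent_set E (Poly_Mapping.keys t)" if t: "t \<in> Poly_Mapping.keys (x * a)" for t
    proof -
      obtain s s' where "t = s + s'" "s' \<in> Poly_Mapping.keys a" using keys_mult t by blast
      then show ?thesis using \<open>a \<in> ?J\<close>
        by (auto simp: dependent_monomial_ideal_def keys_add_nat dest: independent_set_subset)
    qed
    ultimately show ?thesis by (simp add: dependent_monomial_ideal_def)
  qed
  show ?thesis
  proof (rule idealI[OF R.ring_axioms])
    show "subgroup ?J (add_monoid ?R)"
    proof (rule R.add.subgroupI)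
      show "?J \<subseteq> carrier ?R" by (auto simp: dependent_monomial_ideal_def)
      have "0 \<in> ?J" by (auto simp: dependent_monomial_ideal_def mem_poly_ring)
      then show "?J \<noteq> {}" by blast
      fix a b assume ab: "a \<in> ?J" "b \<in> ?J"
      then show "\<ominus>\<^bsub>?R\<^esub> a \<in> ?J"
        by (auto simp: dependent_monomial_ideal_def a_inv_poly_ring mem_poly_ring in_keys_iff)
      show "a \<oplus>\<^bsub>?R\<^esub> b \<in> ?J"
        using ab keys_add[of a b] R.add.m_closed[of a b]
        by (auto simp: dependent_monomial_ideal_def)
    qed
  next
    fix a x assume "a \<in> ?J" "x \<in> carrier ?R"
    then show "x \<otimes>\<^bsub>?R\<^esub> a \<in> ?J" "a \<otimes>\<^bsub>?R\<^esub> x \<in> ?J"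
      using mult by (simp_all add: mult.commute)
  qed
qed

text \<open>
  A monomial with dependent support is divisible by a generator \<open>x\<^sub>u x\<^sub>v\<close>, and a polynomial is the sum of
  its terms.
\<close>
lemma edge_ideal_eq:
  assumes sg: "simple_graph V E"
  shows "edge_ideal V E = (dependent_monomial_ideal V E :: (('v \<Rightarrow>\<^sub>0 nat) \<Rightarrow>\<^sub>0 'k::field) set)"
proof -
  let ?R = "poly_ring V :: (('v \<Rightarrow>\<^sub>0 nat) \<Rightarrow>\<^sub>0 'k::field) ring"
  let ?G = "{mvar u * mvar v | u v. {u, v} \<in> E} :: (('v \<Rightarrow>\<^sub>0 nat) \<Rightarrow>\<^sub>0 'k::field) set"
  interpret R: cring ?R by (rule cring_poly_ring)
  have edge: "u \<in> V" "v \<in> V" "u \<noteq> v" if "{u, v} \<in> E" for u v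
    using that sg by (auto simp: simple_graph_def)
  have G: "?G \<subseteq> dependent_monomial_ideal V E"
  proof -
    have "\<not> independent_set E (Poly_Mapping.keys (Poly_Mapping.single u (1::nat) + Poly_Mapping.single v 1))"
      if "{u, v} \<in> E" for u v
      using that by (auto simp: keys_add_nat not_independent_set_iff)
    then show ?thesis
      using edge by (auto simp: mvar_mult dependent_monomial_ideal_def mem_poly_ring keys_add_nat)
  qed
  have Gc: "?G \<subseteq> carrier ?R"
    using G by (auto simp: dependent_monomial_ideal_def)
  interpret I: ideal "edge_ideal V E :: (('v \<Rightarrow>\<^sub>0 nat) \<Rightarrow>\<^sub>0 'k::field) set" ?R
    unfolding edge_ideal_def by (rule R.genideal_ideal[OF Gc])
  show ?thesis
  proof (rule antisym)
    show "edge_ideal V E \<subseteq> (dependent_monomial_ideal V E :: (('v \<Rightarrow>\<^sub>0 nat) \<Rightarrow>\<^sub>0 'k::field) set)"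
      unfolding edge_ideal_def using G ideal_dependent_monomial_ideal by (rule R.genideal_minimal[rotated])
    show "(dependent_monomial_ideal V E :: (('v \<Rightarrow>\<^sub>0 nat) \<Rightarrow>\<^sub>0 'k::field) set) \<subseteq> edge_ideal V E"
    proof
      fix p :: "('v \<Rightarrow>\<^sub>0 nat) \<Rightarrow>\<^sub>0 'k"
      assume p: "p \<in> dependent_monomial_ideal V E"
      have mono: "Poly_Mapping.single t c \<in> edge_ideal V E" if t: "t \<in> Poly_Mapping.keys p" for t and c :: 'k
      proof -
        obtain u v where uv: "{u, v} \<in> E" "u \<in> Poly_Mapping.keys t" "v \<in> Poly_Mapping.keys t"
          using p t by (auto simp: dependent_monomial_ideal_def not_independent_set_iff)
        have "u \<noteq> v" using edge uv by blast
        define s where "s = t - (Poly_Mapping.single u 1 + Poly_Mapping.single v 1)"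
        have ts: "t = (Poly_Mapping.single u 1 + Poly_Mapping.single v 1) + s"
          using uv \<open>u \<noteq> v\<close> unfolding s_def
          by (intro poly_mapping_eqI) (auto simp: lookup_add lookup_minus lookup_single when_def in_keys_iff)
        have "Poly_Mapping.keys s \<subseteq> Poly_Mapping.keys t"
          by (subst ts) (auto simp: keys_add_nat)
        then have "Poly_Mapping.keys s \<subseteq> V"
          using p t by (auto simp: dependent_monomial_ideal_def mem_poly_ring)
        then have "Poly_Mapping.single s c \<in> carrier ?R" by (auto simp: mem_poly_ring)
        moreover have "mvar u * mvar v \<in> (edge_ideal V E :: (('v \<Rightarrow>\<^sub>0 nat) \<Rightarrow>\<^sub>0 'k::field) set)"
          unfolding edge_ideal_def using uv by (intro subsetD[OF R.genideal_self[OF Gc]]) blast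
        ultimately have "mvar u * mvar v * Poly_Mapping.single s c \<in> edge_ideal V E"
          using I.I_r_closed by simp
        also have "mvar u * mvar v * Poly_Mapping.single s c = Poly_Mapping.single t c"
          by (subst ts) (simp add: mvar_mult mult_single)
        finally show ?thesis .
      qed
      have "(\<Sum>t\<in>T. Poly_Mapping.single t (Poly_Mapping.lookup p t)) \<in> edge_ideal V E"
        if "finite T" "T \<subseteq> Poly_Mapping.keys p" for T
        using that
      proof (induction T rule: finite_induct)
        case empty
        then show ?case using I.zero_closed by simp
      next
        case (insert t T)
        then show ?case using I.a_closed mono by simp
      qed
      from this[of "Poly_Mapping.keys p"] show "p \<in> edge_ideal V E" by (simp add: sum_single)
    qed
  qed
qed

definition int_exponent :: "('v \<Rightarrow>\<^sub>0 nat) \<Rightarrow> 'v \<Rightarrow>\<^sub>0 int" where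
  "int_exponent = Poly_Mapping.map int"

lemma lookup_int_exponent [simp]: "Poly_Mapping.lookup (int_exponent t) v = int (Poly_Mapping.lookup t v)"
  by (simp add: int_exponent_def map.rep_eq when_def)

lemma int_exponent_add: "int_exponent (s + t) = int_exponent s + int_exponent t"
  by (rule poly_mapping_eqI) (simp add: lookup_add)

lemma inj_int_exponent: "int_exponent s = int_exponent t \<longleftrightarrow> s = t"
  by (metis lookup_int_exponent of_nat_eq_iff poly_mapping_eqI)

lemma keys_int_exponent [simp]: "Poly_Mapping.keys (int_exponent t) = Poly_Mapping.keys t"
  by (auto simp: in_keys_iff)

lemma nonneg_exponent:
  assumes "\<And>v. 0 \<le> Poly_Mapping.lookup a v"
  obtains t where "a = int_exponent t"
proof
  show "a = int_exponent (Poly_Mapping.map nat a)"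
    using assms by (intro poly_mapping_eqI) (auto simp: map.rep_eq when_def)
qed

type_synonym ('v, 'k) laurent = "('v \<Rightarrow>\<^sub>0 int) \<Rightarrow>\<^sub>0 'k"

definition to_laurent :: "(('v \<Rightarrow>\<^sub>0 nat) \<Rightarrow>\<^sub>0 'k::field) \<Rightarrow> ('v, 'k) laurent" where
  "to_laurent p = (\<Sum>t\<in>Poly_Mapping.keys p. Poly_Mapping.single (int_exponent t) (Poly_Mapping.lookup p t))"

lemma lookup_to_laurent_eq:
  "Poly_Mapping.lookup (to_laurent p) a =
     (\<Sum>t\<in>Poly_Mapping.keys p. Poly_Mapping.lookup p t when int_exponent t = a)"
  by (simp add: to_laurent_def lookup_sum lookup_single)

lemma lookup_to_laurent [simp]:
  "Poly_Mapping.lookup (to_laurent p) (int_exponent t) = Poly_Mapping.lookup p t"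
  by (auto simp: lookup_to_laurent_eq inj_int_exponent when_def in_keys_iff)

lemma keys_to_laurent: "Poly_Mapping.keys (to_laurent p) = int_exponent ` Poly_Mapping.keys p"
proof (intro equalityI subsetI)
  fix a assume "a \<in> Poly_Mapping.keys (to_laurent p)"
  then have "Poly_Mapping.lookup (to_laurent p) a \<noteq> 0" by (simp add: in_keys_iff)
  then obtain t where "t \<in> Poly_Mapping.keys p" "int_exponent t = a"
    unfolding lookup_to_laurent_eq by (meson sum.not_neutral_contains_not_neutral when_neq_zero)
  then show "a \<in> int_exponent ` Poly_Mapping.keys p" by blast
qed (auto simp: in_keys_iff)

lemma to_laurent_eqI:
  assumes "\<And>t. Poly_Mapping.lookup u (int_exponent t) = Poly_Mapping.lookup p t"
    and "\<And>a. a \<in> Poly_Mapping.keys u \<Longrightarrow> a \<in> range int_exponent"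
  shows "to_laurent p = u"
proof (rule poly_mapping_eqI)
  fix a
  show "Poly_Mapping.lookup (to_laurent p) a = Poly_Mapping.lookup u a"
  proof (cases "a \<in> range int_exponent")
    case True
    then show ?thesis using assms(1) by auto
  next
    case False
    then have "a \<notin> Poly_Mapping.keys u" "a \<notin> Poly_Mapping.keys (to_laurent p)"
      using assms(2) by (auto simp: keys_to_laurent)
    then show ?thesis by (simp add: in_keys_iff)
  qed
qed

lemma to_laurent_add: "to_laurent (p + q) = to_laurent p + to_laurent q"
proof (rule to_laurent_eqI)
  fix a assume "a \<in> Poly_Mapping.keys (to_laurent p + to_laurent q)"
  then have "a \<in> Poly_Mapping.keys (to_laurent p) \<union> Poly_Mapping.keys (to_laurent q)"
    using keys_add[of "to_laurent p" "to_laurent q"] by blast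
  then show "a \<in> range int_exponent" by (auto simp: keys_to_laurent)
qed (simp add: lookup_add)

lemma to_laurent_0 [simp]: "to_laurent 0 = 0"
  by (simp add: to_laurent_def)

lemma to_laurent_uminus: "to_laurent (- p) = - to_laurent p"
  using to_laurent_add[of p "- p"] by (simp add: eq_neg_iff_add_eq_0 add.commute)

lemma to_laurent_diff: "to_laurent (p - q) = to_laurent p - to_laurent q"
  using to_laurent_add[of p "- q"] by (simp add: to_laurent_uminus)

lemma to_laurent_single_mult:
  "to_laurent (Poly_Mapping.single s c * p) = Poly_Mapping.single (int_exponent s) c * to_laurent p"
proof (rule to_laurent_eqI)
  fix t
  show "Poly_Mapping.lookup (Poly_Mapping.single (int_exponent s) c * to_laurent p) (int_exponent t) =
        Poly_Mapping.lookup (Poly_Mapping.single s c * p) t"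
  proof (cases "\<exists>t'. t = s + t'")
    case True
    then obtain t' where "t = s + t'" by blast
    then show ?thesis by (simp add: int_exponent_add lookup_single_mult(1))
  next
    case False
    define b where "b = int_exponent t - int_exponent s"
    have "b \<notin> Poly_Mapping.keys (to_laurent p)"
    proof
      assume "b \<in> Poly_Mapping.keys (to_laurent p)"
      then obtain t' where "b = int_exponent t'" by (auto simp: keys_to_laurent)
      then have "int_exponent t = int_exponent (s + t')" by (simp add: b_def int_exponent_add algebra_simps)
      then show False using False by (simp add: inj_int_exponent)
    qed
    moreover have "int_exponent t = int_exponent s + b" by (simp add: b_def)
    ultimately have "Poly_Mapping.lookup (Poly_Mapping.single (int_exponent s) c * to_laurent p) (int_exponent t) = 0"
      by (simp add: lookup_single_mult(1) in_keys_iff)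
    then show ?thesis using False by (simp add: lookup_single_mult(2))
  qed
next
  fix a assume "a \<in> Poly_Mapping.keys (Poly_Mapping.single (int_exponent s) c * to_laurent p)"
  then obtain x y where "a = x + y" "x \<in> Poly_Mapping.keys (Poly_Mapping.single (int_exponent s) c)"
      "y \<in> Poly_Mapping.keys (to_laurent p)"
    using keys_mult[of "Poly_Mapping.single (int_exponent s) c" "to_laurent p"] by blast
  then obtain t where "a = int_exponent (s + t)"
    by (auto simp: keys_to_laurent int_exponent_add split: if_splits)
  then show "a \<in> range int_exponent" by blast
qed

definition face_exponent :: "'v set \<Rightarrow> int \<Rightarrow> 'v \<Rightarrow>\<^sub>0 int" where
  "face_exponent F k = (\<Sum>v\<in>F. Poly_Mapping.single v k)"

text \<open>
  The power \<open>(\<Prod>v\<in>F. x\<^sub>v)\<^sup>k\<close>, also for negative \<open>k\<close>.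
\<close>
definition face_monomial :: "'v set \<Rightarrow> int \<Rightarrow> ('v, 'k::field) laurent" where
  "face_monomial F k = Poly_Mapping.single (face_exponent F k) 1"

lemma lookup_face_exponent [simp]:
  "finite F \<Longrightarrow> Poly_Mapping.lookup (face_exponent F k) v = (if v \<in> F then k else 0)"
  by (simp add: face_exponent_def lookup_sum lookup_single when_def)

lemma face_exponent_add: "finite F \<Longrightarrow> face_exponent F (j + k) = face_exponent F j + face_exponent F k"
  by (rule poly_mapping_eqI) (simp add: lookup_add)

lemma face_exponent_0 [simp]: "face_exponent F 0 = 0"
  by (simp add: face_exponent_def)

lemma face_exponent_insert: "finite F \<Longrightarrow> v \<notin> F \<Longrightarrow> face_exponent (insert v F) k = Poly_Mapping.single v k + face_exponent F k"
  by (simp add: face_exponent_def)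

lemma face_monomial_mult [simp]:
  "finite F \<Longrightarrow> face_monomial F j * face_monomial F k = face_monomial F (j + k)"
  by (simp add: face_monomial_def mult_single face_exponent_add)

lemma face_monomial_0 [simp]: "face_monomial F 0 = 1"
  by (simp add: face_monomial_def)

lemma lookup_mult_face_monomial:
  "Poly_Mapping.lookup (u * face_monomial F k) a = Poly_Mapping.lookup u (a - face_exponent F k)"
  using lookup_single_mult(1)[of "face_exponent F k" 1 u "a - face_exponent F k"]
  by (simp add: face_monomial_def mult.commute)

text \<open>
  The terms that survive when the edge ideal is divided out and the variables of \<open>F\<close> are inverted. The
  condition on an exponent involves its support only together with \<open>F\<close>, so it is not affected by
  multiplication with powers of the variables of \<open>F\<close>.
\<close>
definition face_part :: "'v set set \<Rightarrow> 'v set \<Rightarrow> ('v, 'k::field) laurent \<Rightarrow> ('v, 'k) laurent" where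
  "face_part E F = Poly_Mapping.mapp (\<lambda>a c. c when independent_set E (Poly_Mapping.keys a \<union> F))"

lemma lookup_face_part:
  "Poly_Mapping.lookup (face_part E F u) a =
     (Poly_Mapping.lookup u a when independent_set E (Poly_Mapping.keys a \<union> F))"
  by (auto simp: face_part_def lookup_mapp when_def in_keys_iff)

lemma face_part_add: "face_part E F (u + w) = face_part E F u + face_part E F w"
  by (rule poly_mapping_eqI) (simp add: lookup_face_part lookup_add when_add_distrib)

lemma face_part_diff: "face_part E F (u - w) = face_part E F u - face_part E F w"
  by (rule poly_mapping_eqI) (simp add: lookup_face_part lookup_minus when_diff_distrib)

lemma face_part_0 [simp]: "face_part E F 0 = 0"
  by (rule poly_mapping_eqI) (simp add: lookup_face_part)

lemma face_part_idem: "G \<subseteq> F \<Longrightarrow> face_part E F (face_part E G u) = face_part E F u"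
  by (rule poly_mapping_eqI)
    (auto simp: lookup_face_part when_def elim: notE dest: independent_set_subset[of _ _ "_ \<union> G"])

lemma keys_shift_face:
  "finite F \<Longrightarrow> Poly_Mapping.keys (a - face_exponent F k) \<union> F = Poly_Mapping.keys a \<union> F"
  by (auto simp: in_keys_iff lookup_minus split: if_splits)

lemma face_part_mult_face_monomial:
  "finite F \<Longrightarrow> face_part E F (u * face_monomial F k) = face_part E F u * face_monomial F k"
  by (rule poly_mapping_eqI)
    (simp add: lookup_face_part lookup_mult_face_monomial keys_shift_face)

section \<open>Localizations of the quotient by an edge ideal\<close>

lemma quotient_module_simps:
  "carrier (quotient_module R I) = carrier (R Quot I)" "zero (quotient_module R I) = zero (R Quot I)"
  "add (quotient_module R I) = add (R Quot I)"
  by (simp_all add: quotient_module_def)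

lemma a_minus_quotient_module:
  "x \<ominus>\<^bsub>quotient_module R I\<^esub> y = x \<ominus>\<^bsub>R Quot I\<^esub> y"
  by (simp add: a_minus_def a_inv_def m_inv_def quotient_module_def)

text \<open>
  The localizations are given by classes of fractions. This lemma transfers their group structure, with
  inverses and finite sums, from Laurent polynomials, where it is available as type class structure.
\<close>
lemma group_embedding:
  fixes \<phi> :: "'a \<Rightarrow> 'b::ab_group_add"
  assumes inj: "inj_on \<phi> (carrier G)"
    and image: "\<phi> ` carrier G = A" "\<And>u w. u \<in> A \<Longrightarrow> w \<in> A \<Longrightarrow> u - w \<in> A"
    and one: "\<one>\<^bsub>G\<^esub> \<in> carrier G" "\<phi> \<one>\<^bsub>G\<^esub> = 0"
    and mult: "\<And>x y. x \<in> carrier G \<Longrightarrow> y \<in> carrier G \<Longrightarrow>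
                 x \<otimes>\<^bsub>G\<^esub> y \<in> carrier G \<and> \<phi> (x \<otimes>\<^bsub>G\<^esub> y) = \<phi> x + \<phi> y"
  shows "comm_group G"
    and "x \<in> carrier G \<Longrightarrow> \<phi> (inv\<^bsub>G\<^esub> x) = - \<phi> x"
    and "finite S \<Longrightarrow> f \<in> S \<rightarrow> carrier G \<Longrightarrow> \<phi> (finprod G f S) = (\<Sum>s\<in>S. \<phi> (f s))"
proof -
  have eq: "x = y" if "x \<in> carrier G" "y \<in> carrier G" "\<phi> x = \<phi> y" for x y
    using inj that by (auto dest: inj_onD)
  show G: "comm_group G"
  proof (rule comm_groupI)
    fix x assume x: "x \<in> carrier G"
    have "0 - \<phi> x \<in> A" using x one image by (metis imageI)
    then obtain y where y: "y \<in> carrier G" "\<phi> y = - \<phi> x" using image(1) by auto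
    then have "y \<otimes>\<^bsub>G\<^esub> x = \<one>\<^bsub>G\<^esub>" using x mult one by (intro eq) auto
    then show "\<exists>y\<in>carrier G. y \<otimes>\<^bsub>G\<^esub> x = \<one>\<^bsub>G\<^esub>" using y by blast
  qed (use mult one in \<open>auto intro!: eq simp: algebra_simps\<close>)
  interpret comm_group G by (rule G)
  show "\<phi> (inv\<^bsub>G\<^esub> x) = - \<phi> x" if x: "x \<in> carrier G" for x
    using mult[of "inv\<^bsub>G\<^esub> x" x] x one by (simp add: eq_neg_iff_add_eq_0)
  show "\<phi> (finprod G f S) = (\<Sum>s\<in>S. \<phi> (f s))" if "finite S" "f \<in> S \<rightarrow> carrier G" for f S
    using that by (induction S rule: finite_induct) (auto simp: one mult)
qed

text \<open>
  Local cohomology is a quotient of the group of cocycles, formed inside the group of all cochains.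
\<close>
lemma FactGroup_trivial_iff:
  assumes "subgroup B G" "\<one>\<^bsub>G\<^esub> \<in> Z" "Z \<subseteq> carrier G" "group G"
  shows "carrier (G\<lparr>carrier := Z\<rparr> Mod B) = {\<one>\<^bsub>G\<lparr>carrier := Z\<rparr> Mod B\<^esub>} \<longleftrightarrow> Z \<subseteq> B"
proof -
  interpret G: group G by fact
  interpret B: subgroup B G by fact
  have coset: "B #>\<^bsub>G\<lparr>carrier := Z\<rparr>\<^esub> z = B #>\<^bsub>G\<^esub> z" for z
    by (simp add: r_coset_def)
  have "B #>\<^bsub>G\<^esub> z = B \<longleftrightarrow> z \<in> B" if "z \<in> Z" for z
  proof
    assume "B #>\<^bsub>G\<^esub> z = B"
    then show "z \<in> B" using G.rcos_self[OF _ assms(1), of z] that assms(3) by blast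
  next
    assume "z \<in> B"
    then show "B #>\<^bsub>G\<^esub> z = B" using G.coset_join2[OF _ assms(1)] that assms(3) by blast
  qed
  then show ?thesis using assms(2) unfolding carrier_FactGroup one_FactGroup coset by auto
qed

locale edge_ideal_quotient =
  fixes V :: "'v::linorder set" and E :: "'v set set" and K :: "'k::field itself"
  assumes simple: "simple_graph V E"
begin

abbreviation R :: "(('v \<Rightarrow>\<^sub>0 nat) \<Rightarrow>\<^sub>0 'k) ring" where
  "R \<equiv> poly_ring V"

abbreviation I :: "(('v \<Rightarrow>\<^sub>0 nat) \<Rightarrow>\<^sub>0 'k) set" where
  "I \<equiv> edge_ideal V E"

abbreviation M :: "(('v \<Rightarrow>\<^sub>0 nat) \<Rightarrow>\<^sub>0 'k, (('v \<Rightarrow>\<^sub>0 nat) \<Rightarrow>\<^sub>0 'k) set) module" where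
  "M \<equiv> quotient_module R I"

sublocale R: cring R
  by (rule cring_poly_ring)

sublocale I: ideal I R
  using edge_ideal_eq[OF simple] ideal_dependent_monomial_ideal by metis

(* This rule reduces membership in the ring to membership in the ideal, which mem_I below reduces
   back to membership in the ring. *)
declare I.a_Hcarr [simp del]

lemma finite_V: "finite V"
  using simple by (simp add: simple_graph_def)

lemma finite_face: "F \<subseteq> V \<Longrightarrow> finite F"
  by (rule finite_subset[OF _ finite_V])

lemma mem_I:
  "p \<in> I \<longleftrightarrow> p \<in> carrier R \<and> (\<forall>t\<in>Poly_Mapping.keys p. \<not> independent_set E (Poly_Mapping.keys t))"
  unfolding edge_ideal_eq[OF simple] dependent_monomial_ideal_def mem_Collect_eq ..

abbreviation coset :: "(('v \<Rightarrow>\<^sub>0 nat) \<Rightarrow>\<^sub>0 'k) \<Rightarrow> (('v \<Rightarrow>\<^sub>0 nat) \<Rightarrow>\<^sub>0 'k) set" where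
  "coset p \<equiv> I +>\<^bsub>R\<^esub> p"

lemma diff_carrier: "p \<in> carrier R \<Longrightarrow> q \<in> carrier R \<Longrightarrow> p - q \<in> carrier R"
  using R.minus_closed[of p q] by (simp add: a_minus_poly_ring)

lemma mult_carrier: "p \<in> carrier R \<Longrightarrow> q \<in> carrier R \<Longrightarrow> p * q \<in> carrier R"
  using R.m_closed[of p q] by simp

lemma add_carrier: "p \<in> carrier R \<Longrightarrow> q \<in> carrier R \<Longrightarrow> p + q \<in> carrier R"
  using R.add.m_closed[of p q] by simp

lemma power_carrier: "p \<in> carrier R \<Longrightarrow> p ^ k \<in> carrier R"
  using R.nat_pow_closed[of p k] by (simp add: nat_pow_poly_ring)

lemma coset_eq_iff: "p \<in> carrier R \<Longrightarrow> q \<in> carrier R \<Longrightarrow> coset p = coset q \<longleftrightarrow> p - q \<in> I"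
  using R.quotient_eq_iff_same_a_r_cos[OF I.ideal_axioms, of p q] by (auto simp: a_minus_poly_ring)

lemma carrier_M: "carrier M = coset ` carrier R"
  by (auto simp: quotient_module_simps FactRing_def A_RCOSETS_def' )

lemma coset_in_M: "p \<in> carrier R \<Longrightarrow> coset p \<in> carrier M"
  by (simp add: carrier_M)

lemma zero_M: "\<zero>\<^bsub>M\<^esub> = coset 0"
proof -
  have "coset \<zero>\<^bsub>R\<^esub> = I" by (rule R.a_rcos_zero[OF I.ideal_axioms I.zero_closed])
  then show ?thesis by (simp add: quotient_module_simps FactRing_def)
qed

lemma add_M: "p \<in> carrier R \<Longrightarrow> q \<in> carrier R \<Longrightarrow> coset p \<oplus>\<^bsub>M\<^esub> coset q = coset (p + q)"
  using I.a_rcos_sum[of p q] by (simp add: quotient_module_simps FactRing_def)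

lemma minus_M:
  assumes "p \<in> carrier R" "q \<in> carrier R"
  shows "coset p \<ominus>\<^bsub>M\<^esub> coset q = coset (p - q)"
proof -
  interpret h: ring_hom_ring R "R Quot I" "(+>\<^bsub>R\<^esub>) I" by (rule I.rcos_ring_hom_ring)
  have "coset p \<ominus>\<^bsub>R Quot I\<^esub> coset q = coset (p \<ominus>\<^bsub>R\<^esub> q)"
    using assms by (simp only: a_minus_def h.hom_add h.hom_a_inv R.a_inv_closed)
  then show ?thesis using assms by (simp add: a_minus_quotient_module a_minus_poly_ring)
qed

lemma smult_M:
  assumes "a \<in> carrier R" "p \<in> carrier R"
  shows "a \<odot>\<^bsub>M\<^esub> coset p = coset (a * p)"
proof -
  have "coset (a * q) = coset (a * p)" if "q \<in> coset p" for q
  proof -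
    have q: "q \<in> carrier R"
      using that R.a_r_coset_subset_G[OF I.a_subset assms(2)] by blast
    then have "q - p \<in> I"
      using that I.a_rcos_module_minus[OF R.ring_axioms assms(2)] assms(2) by (simp add: a_minus_poly_ring)
    then have "a * (q - p) \<in> I" using I.I_l_closed assms(1) by simp
    then show ?thesis using q assms by (simp add: coset_eq_iff mult_carrier right_diff_distrib)
  qed
  moreover have "p \<in> coset p" using assms(2) by (rule I.a_rcos_self)
  ultimately have "(\<Union>q\<in>coset p. coset (a * q)) = coset (a * p)" by blast
  then show ?thesis by (simp add: quotient_module_def)
qed

abbreviation face_product :: "'v set \<Rightarrow> ('v \<Rightarrow>\<^sub>0 nat) \<Rightarrow>\<^sub>0 'k" where
  "face_product F \<equiv> finprod R mvar F"

lemma mvar_carrier: "v \<in> V \<Longrightarrow> mvar v \<in> carrier R"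
  by (simp add: mem_poly_ring mvar_def)

lemma face_product_carrier: "F \<subseteq> V \<Longrightarrow> face_product F \<in> carrier R"
  using mvar_carrier by (intro R.finprod_closed) auto

lemma to_laurent_mvar_mult:
  "to_laurent (mvar v * p) = face_monomial {v} 1 * to_laurent p"
proof -
  have "int_exponent (Poly_Mapping.single v 1) = face_exponent {v} 1"
    by (rule poly_mapping_eqI) (simp add: lookup_single when_def)
  then show ?thesis by (simp add: mvar_def to_laurent_single_mult face_monomial_def)
qed

lemma face_monomial_insert:
  assumes "finite F" "v \<notin> F"
  shows "face_monomial (insert v F) k = face_monomial {v} k * (face_monomial F k :: ('v, 'k) laurent)"
  using assms by (simp add: face_monomial_def mult_single face_exponent_insert face_exponent_def)

lemma to_laurent_face_product_mult:
  assumes "F \<subseteq> V"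
  shows "to_laurent (face_product F * p) = face_monomial F 1 * to_laurent p"
  using finite_face[OF assms] assms
proof (induction F arbitrary: p rule: finite_induct)
  case empty
  then show ?case by (simp add: face_monomial_def face_exponent_def)
next
  case (insert v F)
  then have "face_product (insert v F) = mvar v * face_product F"
    using mvar_carrier by (subst R.finprod_insert) auto
  then show ?case
    using insert by (simp add: to_laurent_mvar_mult face_monomial_insert[OF insert.hyps] mult.assoc)
qed

lemma to_laurent_face_product_power_mult:
  assumes "F \<subseteq> V"
  shows "to_laurent (face_product F ^ k * p) = face_monomial F (int k) * to_laurent p"
proof (induction k arbitrary: p)
  case (Suc k)
  then show ?case
    using assms finite_face[OF assms]
    by (simp add: to_laurent_face_product_mult mult.assoc)
qed simp

lemma to_laurent_mvar_power_mult:
  "to_laurent (mvar v ^ k * p) = face_monomial {v} (int k) * to_laurent p"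
proof (induction k arbitrary: p)
  case (Suc k)
  then show ?case
    by (simp add: to_laurent_mvar_mult mult.assoc) (simp add: mult.assoc[symmetric] add.commute)
qed simp

lemma face_monomial_nonzero: "face_monomial F k \<noteq> (0 :: ('v, 'k) laurent)"
proof -
  have "Poly_Mapping.keys (face_monomial F k :: ('v, 'k) laurent) \<noteq> {}" by (simp add: face_monomial_def)
  then show ?thesis by auto
qed

text \<open>
  Multiplication with the product of the variables of \<open>F\<close> enlarges the support of every monomial of \<open>p\<close>
  by \<open>F\<close>. So a single factor suffices to move into the ideal all monomials that any power moves there,
  namely those whose support is dependent together with \<open>F\<close>.
\<close>
lemma mem_I_iff_face_part:
  assumes F: "F \<subseteq> V" and p: "p \<in> carrier R"
  shows "(\<exists>t. face_product F ^ t * p \<in> I) \<longleftrightarrow> face_part E F (to_laurent p) = 0"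
proof
  have fin: "finite F" using F by (rule finite_face)
  {
    assume "\<exists>t. face_product F ^ t * p \<in> I"
    then obtain t where t: "face_product F ^ t * p \<in> I" by blast
    have "face_part E F (to_laurent (face_product F ^ t * p)) = 0"
    proof (rule poly_mapping_eqI)
      fix a
      show "Poly_Mapping.lookup (face_part E F (to_laurent (face_product F ^ t * p))) a = Poly_Mapping.lookup 0 a"
      proof (cases "a \<in> Poly_Mapping.keys (to_laurent (face_product F ^ t * p))")
        case True
        then have "\<not> independent_set E (Poly_Mapping.keys a)"
          using t by (auto simp: keys_to_laurent mem_I)
        then have "\<not> independent_set E (Poly_Mapping.keys a \<union> F)"
          using independent_set_subset by blast
        then show ?thesis by (simp add: lookup_face_part)
      qed (simp add: lookup_face_part in_keys_iff)
    qed
    then have "face_part E F (to_laurent p) * face_monomial F (int t) = 0"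
      using fin by (simp only: to_laurent_face_product_power_mult[OF F]
          mult.commute[of "face_monomial _ _"] face_part_mult_face_monomial)
    then show "face_part E F (to_laurent p) = 0" by (simp add: face_monomial_nonzero)
  next
    assume 0: "face_part E F (to_laurent p) = 0"
    have "\<not> independent_set E (Poly_Mapping.keys s)" if s: "s \<in> Poly_Mapping.keys (face_product F * p)" for s
    proof
      assume ind: "independent_set E (Poly_Mapping.keys s)"
      define a where "a = int_exponent s - face_exponent F 1"
      have "Poly_Mapping.lookup (to_laurent (face_product F * p)) (int_exponent s) \<noteq> 0"
        using s by (simp add: in_keys_iff)
      then have la: "Poly_Mapping.lookup (to_laurent p) a \<noteq> 0"
        using F by (simp add: a_def to_laurent_face_product_mult mult.commute[of "face_monomial _ _"]
            lookup_mult_face_monomial)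
      then have "a \<in> Poly_Mapping.keys (to_laurent p)" by (simp add: in_keys_iff)
      then obtain t where "a = int_exponent t" by (auto simp: keys_to_laurent)
      then have nonneg: "0 \<le> Poly_Mapping.lookup a v" for v by simp
      have "1 \<le> int (Poly_Mapping.lookup s v)" if "v \<in> F" for v
        using nonneg[of v] that fin by (simp add: a_def lookup_minus)
      then have "F \<subseteq> Poly_Mapping.keys s" by (fastforce simp: in_keys_iff)
      moreover have "Poly_Mapping.keys a \<union> F = Poly_Mapping.keys s \<union> F"
        using keys_shift_face[OF fin, of "int_exponent s" 1] by (simp add: a_def)
      ultimately have "independent_set E (Poly_Mapping.keys a \<union> F)"
        using ind by (simp add: sup.absorb1)
      then show False using la 0 lookup_face_part[of E F "to_laurent p" a] by simp
    qed
    then have "face_product F ^ 1 * p \<in> I"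
      using F p by (simp add: mem_I mult_carrier face_product_carrier)
    then show "\<exists>t. face_product F ^ t * p \<in> I" by blast
  }
qed

text \<open>
  The Laurent polynomial that represents the fraction with numerator \<open>p\<close> and the \<open>k\<close>-th power of the
  product of the variables of \<open>F\<close> as denominator.
\<close>
definition laurent_frac :: "'v set \<Rightarrow> (('v \<Rightarrow>\<^sub>0 nat) \<Rightarrow>\<^sub>0 'k) \<Rightarrow> nat \<Rightarrow> ('v, 'k) laurent" where
  "laurent_frac F p k = face_part E F (to_laurent p * face_monomial F (- int k))"

text \<open>
  Equality of fractions says that a multiple of \<open>x\<^sub>F\<^sup>l p - x\<^sub>F\<^sup>k q\<close> by a power of \<open>x\<^sub>F\<close> lies in the ideal,
  where \<open>x\<^sub>F\<close> is the product of the variables of \<open>F\<close>. Multiplying the face part of this difference by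
  the unit \<open>x\<^sub>F\<^sup>-\<^sup>k\<^sup>-\<^sup>l\<close> yields the difference of the two Laurent polynomials.
\<close>
lemma loc_rel_iff:
  assumes F: "F \<subseteq> V" and p: "p \<in> carrier R" and q: "q \<in> carrier R"
  shows "((coset p, k), (coset q, l)) \<in> loc_rel R M (face_product F) \<longleftrightarrow>
         laurent_frac F p k = laurent_frac F q l"
proof -
  let ?f = "face_product F"
  let ?d = "?f ^ l * p - ?f ^ k * q"
  have fin: "finite F" using F by (rule finite_face)
  have f: "?f \<in> carrier R" using F by (rule face_product_carrier)
  have d: "?d \<in> carrier R" using f p q by (simp add: diff_carrier mult_carrier power_carrier)
  have "((coset p, k), (coset q, l)) \<in> loc_rel R M ?f \<longleftrightarrow> (\<exists>t. coset (?f ^ t * ?d) = coset 0)"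
    using f p q d
    by (simp add: loc_rel_def nat_pow_poly_ring smult_M minus_M zero_M coset_in_M mult_carrier
        power_carrier)
  also have "\<dots> \<longleftrightarrow> (\<exists>t. ?f ^ t * ?d \<in> I)"
    using f d R.zero_closed by (simp add: coset_eq_iff mult_carrier power_carrier)
  also have "\<dots> \<longleftrightarrow> face_part E F (to_laurent ?d) = 0"
    by (rule mem_I_iff_face_part[OF F d])
  also have "\<dots> \<longleftrightarrow> face_part E F (to_laurent ?d) * face_monomial F (- int (k + l)) = 0"
    by (simp add: face_monomial_nonzero)
  also have "face_part E F (to_laurent ?d) * face_monomial F (- int (k + l)) =
      laurent_frac F p k - laurent_frac F q l"
  proof -
    have "to_laurent ?d * face_monomial F (- int (k + l)) =
        to_laurent p * (face_monomial F (int l) * face_monomial F (- int (k + l))) -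
        to_laurent q * (face_monomial F (int k) * face_monomial F (- int (k + l)))"
      by (simp only: to_laurent_diff to_laurent_face_product_power_mult[OF F] left_diff_distrib) (simp only: ac_simps)
    also have "\<dots> = to_laurent p * face_monomial F (- int k) - to_laurent q * face_monomial F (- int l)"
      using fin by simp
    finally show ?thesis
      using fin by (simp only: laurent_frac_def face_part_mult_face_monomial[symmetric] face_part_diff)
  qed
  finally show ?thesis by simp
qed

definition frac :: "'v set \<Rightarrow> (('v \<Rightarrow>\<^sub>0 nat) \<Rightarrow>\<^sub>0 'k) \<Rightarrow> nat \<Rightarrow> ((('v \<Rightarrow>\<^sub>0 nat) \<Rightarrow>\<^sub>0 'k) set \<times> nat) set" where
  "frac F p k = loc_frac R M (face_product F) (coset p) k"

abbreviation loc where
  "loc F \<equiv> localization R M (face_product F)"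

lemma frac_eq:
  assumes F: "F \<subseteq> V" and p: "p \<in> carrier R"
  shows "frac F p k = {(coset q, l) | q l. q \<in> carrier R \<and> laurent_frac F p k = laurent_frac F q l}"
proof (intro equalityI subsetI)
  fix z assume "z \<in> frac F p k"
  then have z: "((coset p, k), z) \<in> loc_rel R M (face_product F)"
    by (simp add: frac_def loc_frac_def)
  then have "fst z \<in> carrier M" by (auto simp: loc_rel_def)
  then obtain q where q: "q \<in> carrier R" "fst z = coset q"
    unfolding carrier_M by blast
  then have zq: "z = (coset q, snd z)" by (simp add: prod_eq_iff)
  with z have "((coset p, k), (coset q, snd z)) \<in> loc_rel R M (face_product F)" by metis
  then have "laurent_frac F p k = laurent_frac F q (snd z)" by (simp only: loc_rel_iff[OF F p q(1)])
  then show "z \<in> {(coset q, l) | q l. q \<in> carrier R \<and> laurent_frac F p k = laurent_frac F q l}"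
    using q(1) zq by blast
next
  fix z assume "z \<in> {(coset q, l) | q l. q \<in> carrier R \<and> laurent_frac F p k = laurent_frac F q l}"
  then show "z \<in> frac F p k"
    using loc_rel_iff[OF F p] by (auto simp: frac_def loc_frac_def)
qed

lemma frac_eq_iff:
  assumes F: "F \<subseteq> V" and pq: "p \<in> carrier R" "q \<in> carrier R"
  shows "frac F p k = frac F q l \<longleftrightarrow> laurent_frac F p k = laurent_frac F q l"
proof
  assume "frac F p k = frac F q l"
  moreover have "(coset p, k) \<in> frac F p k" unfolding frac_eq[OF F pq(1)] using pq by blast
  ultimately have "((coset q, l), (coset p, k)) \<in> loc_rel R M (face_product F)"
    by (simp add: frac_def loc_frac_def)
  then show "laurent_frac F p k = laurent_frac F q l" using loc_rel_iff[OF F pq(2,1)] by simp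
next
  assume "laurent_frac F p k = laurent_frac F q l"
  then show "frac F p k = frac F q l" by (simp only: frac_eq[OF F pq(1)] frac_eq[OF F pq(2)])
qed

lemma carrier_loc: "carrier (loc F) = {frac F p k | p k. p \<in> carrier R}"
proof -
  have "carrier (loc F) = (\<Union>z\<in>carrier M \<times> UNIV. {loc_rel R M (face_product F) `` {z}})"
    by (simp add: localization_def quotient_def)
  also have "\<dots> = {frac F p k | p k. p \<in> carrier R}"
    unfolding carrier_M frac_def loc_frac_def by blast
  finally show ?thesis .
qed

lemma frac_cases:
  assumes "X \<in> carrier (loc F)"
  obtains p k where "p \<in> carrier R" "X = frac F p k"
  using assms unfolding carrier_loc by blast

lemma add_loc:
  assumes F: "F \<subseteq> V" and p: "p \<in> carrier R" and q: "q \<in> carrier R"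
  shows "frac F p k \<oplus>\<^bsub>loc F\<^esub> frac F q l = frac F (face_product F ^ l * p + face_product F ^ k * q) (k + l)"
    and "laurent_frac F (face_product F ^ l * p + face_product F ^ k * q) (k + l) =
         laurent_frac F p k + laurent_frac F q l"
proof -
  let ?f = "face_product F"
  have fin: "finite F" using F by (rule finite_face)
  have f: "?f \<in> carrier R" using F by (rule face_product_carrier)
  have lau: "laurent_frac F (?f ^ l * p + ?f ^ k * q) (k + l) = laurent_frac F p k + laurent_frac F q l" for p q k l
  proof -
    have "to_laurent (?f ^ l * p + ?f ^ k * q) * face_monomial F (- int (k + l)) =
        to_laurent p * (face_monomial F (int l) * face_monomial F (- int (k + l))) +
        to_laurent q * (face_monomial F (int k) * face_monomial F (- int (k + l)))"
      by (simp only: to_laurent_add to_laurent_face_product_power_mult[OF F] distrib_right)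
        (simp only: ac_simps)
    also have "\<dots> = to_laurent p * face_monomial F (- int k) + to_laurent q * face_monomial F (- int l)"
      using fin by simp
    finally show ?thesis by (simp only: laurent_frac_def face_part_add)
  qed
  show "laurent_frac F (?f ^ l * p + ?f ^ k * q) (k + l) = laurent_frac F p k + laurent_frac F q l"
    by (rule lau)
  define c where "c = frac F (?f ^ l * p + ?f ^ k * q) (k + l)"
  define g where "g = (\<lambda>(x, k) (y, l). loc_frac R M ?f (((?f [^]\<^bsub>R\<^esub> l) \<odot>\<^bsub>M\<^esub> x) \<oplus>\<^bsub>M\<^esub> ((?f [^]\<^bsub>R\<^esub> k) \<odot>\<^bsub>M\<^esub> y)) (k + l))"
  have clos: "?f ^ l * p + ?f ^ k * q \<in> carrier R" if "p \<in> carrier R" "q \<in> carrier R" for p q and k l :: nat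
    using that f by (simp only: add_carrier mult_carrier power_carrier)
  have "g x y = c" if x: "x \<in> frac F p k" and y: "y \<in> frac F q l" for x y
  proof -
    obtain p' k' where x': "x = (coset p', k')" "p' \<in> carrier R" "laurent_frac F p k = laurent_frac F p' k'"
      using x unfolding frac_eq[OF F p] by blast
    obtain q' l' where y': "y = (coset q', l')" "q' \<in> carrier R" "laurent_frac F q l = laurent_frac F q' l'"
      using y unfolding frac_eq[OF F q] by blast
    have "g x y = frac F (?f ^ l' * p' + ?f ^ k' * q') (k' + l')"
      using x' y' f by (simp add: g_def frac_def nat_pow_poly_ring smult_M add_M mult_carrier power_carrier)
    also have "\<dots> = c"
      unfolding c_def frac_eq_iff[OF F clos[OF x'(2) y'(2)] clos[OF p q]] lau x'(3) y'(3) ..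
    finally show ?thesis .
  qed
  then have "(\<Union>x\<in>frac F p k. \<Union>y\<in>frac F q l. g x y) = (\<Union>x\<in>frac F p k. \<Union>y\<in>frac F q l. c)"
    by (simp cong: SUP_cong)
  also have "\<dots> = c"
  proof -
    have "(coset p, k) \<in> frac F p k" "(coset q, l) \<in> frac F q l"
      unfolding frac_eq[OF F p] frac_eq[OF F q] using p q by blast+
    then show ?thesis by blast
  qed
  finally show "frac F p k \<oplus>\<^bsub>loc F\<^esub> frac F q l = frac F (?f ^ l * p + ?f ^ k * q) (k + l)"
    by (simp add: localization_def g_def c_def case_prod_beta')
qed

lemma zero_loc: "\<zero>\<^bsub>loc F\<^esub> = frac F 0 0"
  by (simp add: localization_def frac_def zero_M)

lemma zero_carrier: "0 \<in> carrier R"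
  using R.zero_closed by simp

lemma laurent_frac_0 [simp]: "laurent_frac F 0 k = 0"
  by (simp add: laurent_frac_def)

lemma loc_map_frac:
  assumes F: "insert v F \<subseteq> V" "v \<notin> F" and p: "p \<in> carrier R"
  shows "loc_map R M (face_product F) (mvar v) (frac F p k) = frac (insert v F) (mvar v ^ k * p) k"
    and "laurent_frac (insert v F) (mvar v ^ k * p) k = face_part E (insert v F) (laurent_frac F p k)"
proof -
  let ?G = "insert v F"
  have FV: "F \<subseteq> V" "v \<in> V" using F by auto
  have fin: "finite F" using FV by (blast intro: finite_face)
  have x: "mvar v \<in> carrier R" using FV by (simp add: mvar_carrier)
  have prod: "face_product F \<otimes>\<^bsub>R\<^esub> mvar v = face_product ?G"
    using FV fin F(2) mvar_carrier by (subst R.finprod_insert) (auto simp: mult.commute)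
  have lau: "laurent_frac ?G (mvar v ^ k * p) k = face_part E ?G (laurent_frac F p k)" for p k
  proof -
    have "to_laurent (mvar v ^ k * p) * face_monomial ?G (- int k) =
        to_laurent p * face_monomial F (- int k) *
        (face_monomial {v} (int k) * face_monomial {v} (- int k))"
      by (simp only: to_laurent_mvar_power_mult face_monomial_insert[OF fin F(2)]) (simp only: ac_simps)
    then show ?thesis
      by (simp add: laurent_frac_def face_part_idem[of F ?G, OF subset_insertI])
  qed
  show "laurent_frac ?G (mvar v ^ k * p) k = face_part E ?G (laurent_frac F p k)" by (rule lau)
  have clos: "mvar v ^ k * p \<in> carrier R" if "p \<in> carrier R" for p k
    using that x by (simp only: mult_carrier power_carrier)
  define g where "g = (\<lambda>(x, k). loc_frac R M (face_product ?G) ((mvar v [^]\<^bsub>R\<^esub> (k::nat)) \<odot>\<^bsub>M\<^esub> x) k)"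
  have "g z = frac ?G (mvar v ^ k * p) k" if z: "z \<in> frac F p k" for z
  proof -
    obtain q l where z': "z = (coset q, l)" "q \<in> carrier R" "laurent_frac F p k = laurent_frac F q l"
      using z unfolding frac_eq[OF FV(1) p] by blast
    have "g z = frac ?G (mvar v ^ l * q) l"
      using z' x by (simp add: g_def frac_def nat_pow_poly_ring smult_M power_carrier)
    also have "\<dots> = frac ?G (mvar v ^ k * p) k"
      unfolding frac_eq_iff[OF F(1) clos[OF z'(2)] clos[OF p]] lau z'(3) ..
    finally show ?thesis .
  qed
  moreover have "(coset p, k) \<in> frac F p k" unfolding frac_eq[OF FV(1) p] using p by blast
  ultimately have "(\<Union>z\<in>frac F p k. g z) = frac ?G (mvar v ^ k * p) k" by blast
  then show "loc_map R M (face_product F) (mvar v) (frac F p k) = frac ?G (mvar v ^ k * p) k"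
    unfolding loc_map_def prod by (simp add: g_def)
qed


definition coord :: "'v set \<Rightarrow> ((('v \<Rightarrow>\<^sub>0 nat) \<Rightarrow>\<^sub>0 'k) set \<times> nat) set \<Rightarrow> ('v, 'k) laurent" where
  "coord F X = (THE u. \<exists>p k. p \<in> carrier R \<and> X = frac F p k \<and> u = laurent_frac F p k)"

lemma coord_frac:
  assumes "F \<subseteq> V" "p \<in> carrier R"
  shows "coord F (frac F p k) = laurent_frac F p k"
  unfolding coord_def
proof (rule the_equality)
  show "\<exists>q l. q \<in> carrier R \<and> frac F p k = frac F q l \<and> laurent_frac F p k = laurent_frac F q l"
    using assms by blast
  show "u = laurent_frac F p k"
    if "\<exists>q l. q \<in> carrier R \<and> frac F p k = frac F q l \<and> u = laurent_frac F q l" for u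
    using that frac_eq_iff[OF assms(1)] assms(2) by auto
qed

text \<open>
  The Laurent polynomials that represent elements of the localization: an exponent may be negative at
  vertices of \<open>F\<close> only, and its support must be independent together with \<open>F\<close>.
\<close>
definition laurent_module :: "'v set \<Rightarrow> ('v, 'k) laurent set" where
  "laurent_module F = {u. \<forall>a\<in>Poly_Mapping.keys u. Poly_Mapping.keys a \<subseteq> V \<and>
     independent_set E (Poly_Mapping.keys a \<union> F) \<and> (\<forall>v. Poly_Mapping.lookup a v < 0 \<longrightarrow> v \<in> F)}"

lemma laurent_module_diff:
  assumes "u \<in> laurent_module F" "w \<in> laurent_module F"
  shows "u - w \<in> laurent_module F"
proof -
  have "Poly_Mapping.keys (u - w) \<subseteq> Poly_Mapping.keys u \<union> Poly_Mapping.keys w"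
    by (auto simp: in_keys_iff lookup_minus)
  then show ?thesis using assms unfolding laurent_module_def by blast
qed

lemma laurent_frac_in_laurent_module:
  assumes F: "F \<subseteq> V" and p: "p \<in> carrier R"
  shows "laurent_frac F p k \<in> laurent_module F"
  unfolding laurent_module_def
proof (intro CollectI ballI conjI allI impI)
  fix a assume "a \<in> Poly_Mapping.keys (laurent_frac F p k)"
  then have "Poly_Mapping.lookup (laurent_frac F p k) a \<noteq> 0" by (simp add: in_keys_iff)
  then have ind: "independent_set E (Poly_Mapping.keys a \<union> F)"
    and "Poly_Mapping.lookup (to_laurent p) (a - face_exponent F (- int k)) \<noteq> 0"
    by (auto simp: laurent_frac_def lookup_face_part lookup_mult_face_monomial)
  then have "a - face_exponent F (- int k) \<in> Poly_Mapping.keys (to_laurent p)"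
    by (simp add: in_keys_iff)
  then obtain t where t: "t \<in> Poly_Mapping.keys p" "a - face_exponent F (- int k) = int_exponent t"
    by (auto simp: keys_to_laurent)
  then have a: "a = int_exponent t + face_exponent F (- int k)" by (simp add: algebra_simps)
  show "independent_set E (Poly_Mapping.keys a \<union> F)" by (rule ind)
  have "Poly_Mapping.keys a \<subseteq> Poly_Mapping.keys t \<union> F"
    using finite_face[OF F] unfolding a by (auto simp: in_keys_iff lookup_add split: if_splits)
  then show "Poly_Mapping.keys a \<subseteq> V" using p t(1) F unfolding mem_poly_ring by blast
  show "v \<in> F" if "Poly_Mapping.lookup a v < 0" for v
    using that finite_face[OF F] unfolding a by (auto simp: lookup_add split: if_splits)
qed

text \<open>
  The finitely many exponents of \<open>u\<close> become nonnegative after multiplication with a high power of the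
  product of the variables of \<open>F\<close>.
\<close>
lemma laurent_module_fraction:
  assumes F: "F \<subseteq> V" and u: "u \<in> laurent_module F"
  obtains p k where "p \<in> carrier R" "u = laurent_frac F p k"
proof -
  have fin: "finite F" using F by (rule finite_face)
  have "finite ((\<lambda>(a, v). nat (- Poly_Mapping.lookup a v)) ` (Poly_Mapping.keys u \<times> F))"
    using fin by simp
  then obtain k where k: "nat (- Poly_Mapping.lookup a v) \<le> k"
    if "a \<in> Poly_Mapping.keys u" "v \<in> F" for a v
    unfolding finite_nat_set_iff_bounded_le by fastforce
  define w where "w = u * face_monomial F (int k)"
  define p where "p = Poly_Mapping.map_key int_exponent w"
  have inj: "inj int_exponent" by (simp add: inj_on_def inj_int_exponent)
  have lookup_p: "Poly_Mapping.lookup p t = Poly_Mapping.lookup w (int_exponent t)" for t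
    using inj by (simp add: p_def map_key.rep_eq[OF inj])
  have w_keys: "a - face_exponent F (int k) \<in> Poly_Mapping.keys u" if "a \<in> Poly_Mapping.keys w" for a
    using that by (simp add: w_def in_keys_iff lookup_mult_face_monomial)
  have "to_laurent p = w"
  proof (rule to_laurent_eqI)
    fix a assume "a \<in> Poly_Mapping.keys w"
    then have a: "a - face_exponent F (int k) \<in> Poly_Mapping.keys u" by (rule w_keys)
    have "0 \<le> Poly_Mapping.lookup a v" for v
    proof (cases "v \<in> F")
      case True
      then show ?thesis using k[OF a True] fin by (simp add: lookup_minus)
    next
      case False
      then have "\<not> Poly_Mapping.lookup (a - face_exponent F (int k)) v < 0"
        using u a unfolding laurent_module_def by blast
      then show ?thesis using False fin by (simp add: lookup_minus)
    qed
    then show "a \<in> range int_exponent" using nonneg_exponent[of a] by blast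
  qed (simp add: lookup_p)
  have "p \<in> carrier R"
    unfolding mem_poly_ring
  proof
    fix t assume "t \<in> Poly_Mapping.keys p"
    then have "int_exponent t \<in> Poly_Mapping.keys w" by (simp add: in_keys_iff lookup_p)
    then have "Poly_Mapping.keys (int_exponent t - face_exponent F (int k)) \<subseteq> V"
      using w_keys u unfolding laurent_module_def by blast
    then show "Poly_Mapping.keys t \<subseteq> V"
      using keys_shift_face[OF fin, of "int_exponent t" "int k"] F by auto
  qed
  moreover have "laurent_frac F p k = u"
  proof -
    have "laurent_frac F p k = face_part E F u"
      using fin by (simp add: laurent_frac_def \<open>to_laurent p = w\<close> w_def mult.assoc)
    also have "\<dots> = u"
    proof (rule poly_mapping_eqI)
      fix a
      have "independent_set E (Poly_Mapping.keys a \<union> F)" if "Poly_Mapping.lookup u a \<noteq> 0"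
        using that u by (simp add: laurent_module_def in_keys_iff)
      then show "Poly_Mapping.lookup (face_part E F u) a = Poly_Mapping.lookup u a"
        by (auto simp: lookup_face_part when_def)
    qed
    finally show ?thesis .
  qed
  ultimately show thesis using that by blast
qed

lemma coord_image:
  assumes F: "F \<subseteq> V"
  shows "coord F ` carrier (loc F) = laurent_module F"
proof (intro equalityI subsetI)
  fix u assume "u \<in> coord F ` carrier (loc F)"
  then obtain p k where "p \<in> carrier R" "u = coord F (frac F p k)"
    unfolding carrier_loc by blast
  then show "u \<in> laurent_module F"
    using F by (simp only: coord_frac laurent_frac_in_laurent_module)
next
  fix u assume "u \<in> laurent_module F"
  then obtain p k where p: "p \<in> carrier R" "u = laurent_frac F p k"
    using laurent_module_fraction[OF F] by blast
  then have "u = coord F (frac F p k)" using F by (simp only: coord_frac)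
  moreover have "frac F p k \<in> carrier (loc F)" using p unfolding carrier_loc by blast
  ultimately show "u \<in> coord F ` carrier (loc F)" by blast
qed

lemma inj_on_coord:
  assumes F: "F \<subseteq> V"
  shows "inj_on (coord F) (carrier (loc F))"
proof (rule inj_onI)
  fix X Y assume XY: "X \<in> carrier (loc F)" "Y \<in> carrier (loc F)" "coord F X = coord F Y"
  obtain p k where p: "p \<in> carrier R" "X = frac F p k" using XY(1) by (rule frac_cases)
  obtain q l where q: "q \<in> carrier R" "Y = frac F q l" using XY(2) by (rule frac_cases)
  have "laurent_frac F p k = laurent_frac F q l"
    using XY(3) unfolding p(2) q(2) coord_frac[OF F p(1)] coord_frac[OF F q(1)] .
  then show "X = Y" unfolding p(2) q(2) frac_eq_iff[OF F p(1) q(1)] .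
qed

lemma zero_loc_closed: "\<zero>\<^bsub>loc F\<^esub> \<in> carrier (loc F)"
  unfolding carrier_loc zero_loc using zero_carrier by blast

lemma coord_zero: "F \<subseteq> V \<Longrightarrow> coord F \<zero>\<^bsub>loc F\<^esub> = 0"
  by (simp only: zero_loc coord_frac zero_carrier laurent_frac_0)

lemma coord_add:
  assumes F: "F \<subseteq> V" and X: "X \<in> carrier (loc F)" and Y: "Y \<in> carrier (loc F)"
  shows "X \<oplus>\<^bsub>loc F\<^esub> Y \<in> carrier (loc F) \<and> coord F (X \<oplus>\<^bsub>loc F\<^esub> Y) = coord F X + coord F Y"
proof -
  obtain p k where p: "p \<in> carrier R" "X = frac F p k" using X by (rule frac_cases)
  obtain q l where q: "q \<in> carrier R" "Y = frac F q l" using Y by (rule frac_cases)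
  let ?r = "face_product F ^ l * p + face_product F ^ k * q"
  have r: "?r \<in> carrier R"
    using p(1) q(1) face_product_carrier[OF F] by (simp only: add_carrier mult_carrier power_carrier)
  have "coord F X + coord F Y = laurent_frac F ?r (k + l)"
    unfolding p(2) q(2) coord_frac[OF F p(1)] coord_frac[OF F q(1)] add_loc(2)[OF F p(1) q(1)] ..
  moreover have XY: "X \<oplus>\<^bsub>loc F\<^esub> Y = frac F ?r (k + l)"
    unfolding p(2) q(2) by (rule add_loc(1)[OF F p(1) q(1)])
  ultimately have "coord F (X \<oplus>\<^bsub>loc F\<^esub> Y) = coord F X + coord F Y"
    by (simp only: coord_frac[OF F r])
  moreover have "X \<oplus>\<^bsub>loc F\<^esub> Y \<in> carrier (loc F)"
    unfolding XY carrier_loc using r by blast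
  ultimately show ?thesis by blast
qed

lemma comm_group_loc: "F \<subseteq> V \<Longrightarrow> comm_group (add_monoid (loc F))"
  and coord_a_inv: "F \<subseteq> V \<Longrightarrow> X \<in> carrier (loc F) \<Longrightarrow> coord F (\<ominus>\<^bsub>loc F\<^esub> X) = - coord F X"
  and coord_finsum: "F \<subseteq> V \<Longrightarrow> finite S \<Longrightarrow> f \<in> S \<rightarrow> carrier (loc F) \<Longrightarrow>
        coord F (finsum (loc F) f S) = (\<Sum>s\<in>S. coord F (f s))"
proof -
  assume F: "F \<subseteq> V"
  let ?G = "add_monoid (loc F)"
  have inj: "inj_on (coord F) (carrier ?G)" using inj_on_coord[OF F] by simp
  have image: "coord F ` carrier ?G = laurent_module F" using coord_image[OF F] by simp
  have one: "\<one>\<^bsub>?G\<^esub> \<in> carrier ?G" "coord F \<one>\<^bsub>?G\<^esub> = 0"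
    using zero_loc_closed coord_zero[OF F] by simp_all
  have mult: "X \<otimes>\<^bsub>?G\<^esub> Y \<in> carrier ?G \<and> coord F (X \<otimes>\<^bsub>?G\<^esub> Y) = coord F X + coord F Y"
    if "X \<in> carrier ?G" "Y \<in> carrier ?G" for X Y
    using coord_add[OF F] that by simp
  note emb = group_embedding[OF inj image laurent_module_diff one mult]
  show "comm_group (add_monoid (loc F))" by (rule emb(1))
  show "coord F (\<ominus>\<^bsub>loc F\<^esub> X) = - coord F X" if "X \<in> carrier (loc F)"
    unfolding a_inv_def using that by (intro emb(2)) simp_all
  show "coord F (finsum (loc F) f S) = (\<Sum>s\<in>S. coord F (f s))"
    if "finite S" "f \<in> S \<rightarrow> carrier (loc F)"
    unfolding finsum_def using that by (intro emb(3)) simp_all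
qed

text \<open>
  In coordinates the maps of the Cech complex forget the terms that do not survive in the larger
  localization. They do not depend on the exponents otherwise, so the complex splits into its degrees.
\<close>
lemma loc_map_closed:
  assumes F: "insert v F \<subseteq> V" "v \<notin> F" and X: "X \<in> carrier (loc F)"
  shows "loc_map R M (face_product F) (mvar v) X \<in> carrier (loc (insert v F))"
    and "coord (insert v F) (loc_map R M (face_product F) (mvar v) X) = face_part E (insert v F) (coord F X)"
proof -
  obtain p k where p: "p \<in> carrier R" "X = frac F p k" using X by (rule frac_cases)
  have FV: "F \<subseteq> V" "v \<in> V" using F by auto
  have q: "mvar v ^ k * p \<in> carrier R"
    using p(1) mvar_carrier[OF FV(2)] by (simp only: mult_carrier power_carrier)
  show "loc_map R M (face_product F) (mvar v) X \<in> carrier (loc (insert v F))"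
    unfolding p(2) loc_map_frac(1)[OF F p(1)] carrier_loc using q by blast
  show "coord (insert v F) (loc_map R M (face_product F) (mvar v) X) = face_part E (insert v F) (coord F X)"
    unfolding p(2) loc_map_frac(1)[OF F p(1)] coord_frac[OF F(1) q] coord_frac[OF FV(1) p(1)]
    by (rule loc_map_frac(2)[OF F p(1)])
qed

section \<open>The Cech complex of the quotient by an edge ideal\<close>

abbreviation cochains where
  "cochains i \<equiv> cech_cochains R mvar V M i"

abbreviation diff where
  "diff i \<equiv> cech_diff R mvar V M i"

abbreviation faces where
  "faces i \<equiv> {F. F \<subseteq> V \<and> card F = i}"

lemma carrier_cochains: "carrier (cochains i) = (\<Pi>\<^sub>E F\<in>faces i. carrier (loc F))"
  by (simp add: cech_cochains_def)

lemma group_cochains: "group (cochains i)"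
  unfolding cech_cochains_def
  by (intro product_group) (auto intro: comm_group.axioms comm_group_loc)

lemma cochain_eqI:
  assumes "c \<in> carrier (cochains i)" "c' \<in> carrier (cochains i)"
    and "\<And>F a. F \<subseteq> V \<Longrightarrow> card F = i \<Longrightarrow>
           Poly_Mapping.lookup (coord F (c F)) a = Poly_Mapping.lookup (coord F (c' F)) a"
  shows "c = c'"
proof (rule PiE_ext)
  show "c \<in> (\<Pi>\<^sub>E F\<in>faces i. carrier (loc F))" "c' \<in> (\<Pi>\<^sub>E F\<in>faces i. carrier (loc F))"
    using assms(1,2) unfolding carrier_cochains by blast+
  fix F assume F: "F \<in> faces i"
  then have "coord F (c F) = coord F (c' F)" using assms(3) by (intro poly_mapping_eqI) blast
  moreover have "c F \<in> carrier (loc F)" "c' F \<in> carrier (loc F)"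
    using assms(1,2) F unfolding carrier_cochains by (auto dest: PiE_mem)
  ultimately show "c F = c' F" using inj_on_coord F by (auto dest: inj_onD)
qed

lemma diff_coord:
  assumes c: "c \<in> carrier (cochains i)" and G: "G \<subseteq> V" "card G = Suc i"
  shows "diff i c G \<in> carrier (loc G)"
    and "Poly_Mapping.lookup (coord G (diff i c G)) a =
      (coboundary (\<lambda>F. Poly_Mapping.lookup (coord F (c F)) a) G
        when independent_set E (Poly_Mapping.keys a \<union> G))"
proof -
  interpret L: comm_group "add_monoid (loc G)" by (rule comm_group_loc[OF G(1)])
  define y where "y v = loc_map R M (face_product (G - {v})) (mvar v) (c (G - {v}))" for v
  define z where "z v = (if even (card {b \<in> G. b < v}) then y v else \<ominus>\<^bsub>loc G\<^esub> y v)" for v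
  have fin: "finite G" using G(1) by (rule finite_face)
  have y: "y v \<in> carrier (loc G)" "coord G (y v) = face_part E G (coord (G - {v}) (c (G - {v})))"
    if v: "v \<in> G" for v
  proof -
    have ins: "insert v (G - {v}) = G" using v by blast
    have "G - {v} \<in> faces i" using G v fin by auto
    then have cv: "c (G - {v}) \<in> carrier (loc (G - {v}))"
      using c unfolding carrier_cochains by (auto dest: PiE_mem)
    show "y v \<in> carrier (loc G)" "coord G (y v) = face_part E G (coord (G - {v}) (c (G - {v})))"
      using loc_map_closed[of v "G - {v}", unfolded ins, OF G(1) _ cv] by (auto simp: y_def)
  qed
  have z: "z v \<in> carrier (loc G)" if v: "v \<in> G" for v
    using y(1)[OF v] L.inv_closed by (auto simp: z_def a_inv_def)
  have d: "diff i c G = finsum (loc G) z G"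
    using G unfolding cech_diff_def Let_def z_def[abs_def] y_def[abs_def] by simp
  show "diff i c G \<in> carrier (loc G)"
    using L.finprod_closed[of z G] z unfolding d finsum_def by auto
  have "coord G (z v) = face_part E G (coord (G - {v}) (c (G - {v}))) \<and> even (card {b \<in> G. b < v}) \<or>
        coord G (z v) = - face_part E G (coord (G - {v}) (c (G - {v}))) \<and> odd (card {b \<in> G. b < v})"
    if v: "v \<in> G" for v
    using y[OF v] coord_a_inv[OF G(1) y(1)[OF v]] by (auto simp: z_def)
  then have "Poly_Mapping.lookup (coord G (z v)) a =
      (incidence_sign v G * Poly_Mapping.lookup (coord (G - {v}) (c (G - {v}))) a
        when independent_set E (Poly_Mapping.keys a \<union> G))" if "v \<in> G" for v
    using that by (fastforce simp: incidence_sign_def lookup_face_part when_def)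
  moreover have "coord G (diff i c G) = (\<Sum>v\<in>G. coord G (z v))"
    unfolding d using z by (intro coord_finsum G fin) auto
  ultimately show "Poly_Mapping.lookup (coord G (diff i c G)) a =
      (coboundary (\<lambda>F. Poly_Mapping.lookup (coord F (c F)) a) G
        when independent_set E (Poly_Mapping.keys a \<union> G))"
    by (simp add: lookup_sum coboundary_def when_def)
qed

text \<open>
  The component of a Cech cochain in the degree \<open>a\<close>, as a cochain on finite sets. It is extended by zero
  to all sets, so that \<open>coboundary\<close> can be applied.
\<close>
definition coef :: "('v set \<Rightarrow> ((('v \<Rightarrow>\<^sub>0 nat) \<Rightarrow>\<^sub>0 'k) set \<times> nat) set) \<Rightarrow> ('v \<Rightarrow>\<^sub>0 int) \<Rightarrow> nat \<Rightarrow> 'v set \<Rightarrow> 'k" where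
  "coef c a i F = (if F \<in> faces i then Poly_Mapping.lookup (coord F (c F)) a else 0)"

text \<open>
  The sets \<open>F\<close> for which the Laurent monomial with exponent \<open>a\<close> is nonzero in the localization at the
  variables of \<open>F\<close>.
\<close>
definition degree_faces :: "('v \<Rightarrow>\<^sub>0 int) \<Rightarrow> 'v set set" where
  "degree_faces a = {F. F \<subseteq> V \<and> {v. Poly_Mapping.lookup a v < 0} \<subseteq> F \<and>
     independent_set E (Poly_Mapping.keys a \<union> F)}"

lemma cochain_component:
  "c \<in> carrier (cochains i) \<Longrightarrow> F \<in> faces i \<Longrightarrow> c F \<in> carrier (loc F)"
  unfolding carrier_cochains by (rule PiE_mem)

lemma coord_in_laurent_module:
  assumes "c \<in> carrier (cochains i)" "F \<in> faces i"
  shows "coord F (c F) \<in> laurent_module F"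
  using cochain_component[OF assms] coord_image[of F] assms(2) by blast

lemma coef_supported:
  assumes c: "c \<in> carrier (cochains i)"
  shows "supported_on (degree_faces a) (coef c a i)"
  unfolding supported_on_def
proof (intro allI impI)
  fix F assume "coef c a i F \<noteq> 0"
  then have F: "F \<in> faces i" and a: "a \<in> Poly_Mapping.keys (coord F (c F))"
    by (auto simp: coef_def in_keys_iff split: if_splits)
  then show "F \<in> degree_faces a"
    using coord_in_laurent_module[OF c F] unfolding laurent_module_def degree_faces_def by blast
qed

lemma cochain_eqI_coef:
  assumes "c \<in> carrier (cochains i)" "c' \<in> carrier (cochains i)"
    and "\<And>F a. F \<in> faces i \<Longrightarrow> coef c a i F = coef c' a i F"
  shows "c = c'"
  using assms(1,2)
proof (rule cochain_eqI)
  fix F a assume "F \<subseteq> V" "card F = i"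
  then show "Poly_Mapping.lookup (coord F (c F)) a = Poly_Mapping.lookup (coord F (c' F)) a"
    using assms(3)[of F a] by (simp add: coef_def)
qed

lemma coef_diff:
  assumes c: "c \<in> carrier (cochains i)" and G: "G \<in> faces (Suc i)"
  shows "coef (diff i c) a (Suc i) G =
    (coboundary (coef c a i) G when independent_set E (Poly_Mapping.keys a \<union> G))"
proof -
  have "coboundary (\<lambda>F. Poly_Mapping.lookup (coord F (c F)) a) G = coboundary (coef c a i) G"
    unfolding coboundary_def
  proof (intro sum.cong refl)
    fix v assume "v \<in> G"
    then have "G - {v} \<in> faces i" using G finite_face by auto
    then show "incidence_sign v G * Poly_Mapping.lookup (coord (G - {v}) (c (G - {v}))) a =
          incidence_sign v G * coef c a i (G - {v})"
      by (simp add: coef_def)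
  qed
  then show ?thesis using diff_coord(2)[OF c, of G a] G by (simp add: coef_def)
qed

lemma diff_closed:
  assumes c: "c \<in> carrier (cochains i)"
  shows "diff i c \<in> carrier (cochains (Suc i))"
  unfolding carrier_cochains
proof (rule PiE_I)
  fix G assume "G \<in> faces (Suc i)"
  then show "diff i c G \<in> carrier (loc G)" using diff_coord(1)[OF c] by blast
next
  fix G assume "G \<notin> faces (Suc i)"
  then show "diff i c G = undefined" unfolding cech_diff_def restrict_def by (rule if_not_P)
qed

lemma coef_mult:
  assumes "c \<in> carrier (cochains i)" "c' \<in> carrier (cochains i)"
  shows "coef (c \<otimes>\<^bsub>cochains i\<^esub> c') a i F = coef c a i F + coef c' a i F"
proof (cases "F \<in> faces i")
  case True
  then have "coord F (c F \<oplus>\<^bsub>loc F\<^esub> c' F) = coord F (c F) + coord F (c' F)"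
    using coord_add[of F "c F" "c' F"] cochain_component assms by blast
  then show ?thesis using True by (simp add: coef_def cech_cochains_def lookup_add)
next
  case False
  then show ?thesis by (simp only: coef_def if_False add_0)
qed

lemma coef_one: "coef \<one>\<^bsub>cochains i\<^esub> a i F = 0"
  using coord_zero[of F] by (auto simp: coef_def cech_cochains_def)

lemma one_cochains_closed: "\<one>\<^bsub>cochains i\<^esub> \<in> carrier (cochains i)"
  using group_cochains by (rule group.is_monoid[THEN monoid.one_closed])

lemma diff_hom: "group_hom (cochains i) (cochains (Suc i)) (diff i)"
proof -
  interpret C: group "cochains i" by (rule group_cochains)
  have "diff i (c \<otimes>\<^bsub>cochains i\<^esub> c') = diff i c \<otimes>\<^bsub>cochains (Suc i)\<^esub> diff i c'"
    if c: "c \<in> carrier (cochains i)" and c': "c' \<in> carrier (cochains i)" for c c'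
  proof (rule cochain_eqI_coef)
    show "diff i (c \<otimes>\<^bsub>cochains i\<^esub> c') \<in> carrier (cochains (Suc i))"
      using C.m_closed[OF c c'] by (rule diff_closed)
    show "diff i c \<otimes>\<^bsub>cochains (Suc i)\<^esub> diff i c' \<in> carrier (cochains (Suc i))"
      using group.is_monoid[OF group_cochains] diff_closed[OF c] diff_closed[OF c']
      by (rule monoid.m_closed)
    fix G a assume G: "G \<in> faces (Suc i)"
    have "coboundary (coef (c \<otimes>\<^bsub>cochains i\<^esub> c') a i) G =
        coboundary (coef c a i) G + coboundary (coef c' a i) G"
      unfolding coboundary_def coef_mult[OF c c'] by (simp add: distrib_left sum.distrib)
    then show "coef (diff i (c \<otimes>\<^bsub>cochains i\<^esub> c')) a (Suc i) G =
        coef (diff i c \<otimes>\<^bsub>cochains (Suc i)\<^esub> diff i c') a (Suc i) G"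
      by (simp only: coef_mult[OF diff_closed[OF c] diff_closed[OF c']] coef_diff[OF c G]
          coef_diff[OF c' G] coef_diff[OF C.m_closed[OF c c'] G] when_add_distrib)
  qed
  then show ?thesis
    using group_cochains diff_closed by (simp add: group_hom_def group_hom_axioms_def hom_def)
qed

abbreviation cocycles where
  "cocycles i \<equiv> cech_cocycles R mvar V M i"

abbreviation coboundaries where
  "coboundaries i \<equiv> cech_coboundaries R mvar V M i"

lemma mem_cocycles:
  "c \<in> cocycles i \<longleftrightarrow> c \<in> carrier (cochains i) \<and>
     (\<forall>G\<in>faces (Suc i). \<forall>a. independent_set E (Poly_Mapping.keys a \<union> G) \<longrightarrow> coboundary (coef c a i) G = 0)"
proof (cases "c \<in> carrier (cochains i)")
  case c: True
  have "c \<in> cocycles i \<longleftrightarrow> diff i c = \<one>\<^bsub>cochains (Suc i)\<^esub>"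
    using c by (simp add: cech_cocycles_def kernel_def)
  also have "\<dots> \<longleftrightarrow> (\<forall>G\<in>faces (Suc i). \<forall>a. coef (diff i c) a (Suc i) G = 0)"
  proof
    assume "\<forall>G\<in>faces (Suc i). \<forall>a. coef (diff i c) a (Suc i) G = 0"
    then show "diff i c = \<one>\<^bsub>cochains (Suc i)\<^esub>"
      by (intro cochain_eqI_coef[OF diff_closed[OF c] one_cochains_closed]) (simp only: coef_one)
  qed (simp add: coef_one)
  also have "\<dots> \<longleftrightarrow> (\<forall>G\<in>faces (Suc i). \<forall>a. independent_set E (Poly_Mapping.keys a \<union> G) \<longrightarrow>
      coboundary (coef c a i) G = 0)"
    by (intro ball_cong refl) (simp only: coef_diff[OF c] when_def, metis)
  finally show ?thesis using c by blast
next
  case False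
  then show ?thesis by (simp add: cech_cocycles_def kernel_def)
qed

lemma subgroup_coboundaries: "subgroup (coboundaries i) (cochains i)"
proof (cases i)
  case 0
  then show ?thesis
    using group.triv_subgroup[OF group_cochains[of 0]] by (simp add: cech_coboundaries_def)
next
  case (Suc j)
  then show ?thesis
    using group_hom.img_is_subgroup[OF diff_hom[of j]] by (simp add: cech_coboundaries_def)
qed

lemma local_cohomology_trivial_iff:
  "carrier (local_cohomology R mvar V M i) = {\<one>\<^bsub>local_cohomology R mvar V M i\<^esub>} \<longleftrightarrow>
     cocycles i \<subseteq> coboundaries i"
  unfolding local_cohomology_def
proof (rule FactGroup_trivial_iff)
  show "subgroup (coboundaries i) (cochains i)" by (rule subgroup_coboundaries)
  show "cocycles i \<subseteq> carrier (cochains i)" using mem_cocycles by blast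
  show "\<one>\<^bsub>cochains i\<^esub> \<in> cocycles i"
    unfolding mem_cocycles using one_cochains_closed by (simp add: coboundary_def coef_one)
  show "group (cochains i)" by (rule group_cochains)
qed

text \<open>
  A vertex \<open>w\<close> with positive exponent is in the support of \<open>a\<close> and not required to be in \<open>F\<close>, so it can
  be added to and removed from every face. If no exponent is positive, the support \<open>N\<close> of \<open>a\<close> equals
  its negative part, and the faces are the independent sets above \<open>N\<close>.
\<close>
lemma acyclic_at_degree_faces:
  assumes nc: "\<nexists>p. graph_cycle V E p"
    and d: "\<And>F. maximal_independent_set V E F \<Longrightarrow> i < card F"
    and a: "Poly_Mapping.keys a \<subseteq> V"
  shows "acyclic_at TYPE('k) (degree_faces a) i"
proof (cases "\<exists>w. 0 < Poly_Mapping.lookup a w")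
  case True
  then obtain w where w: "0 < Poly_Mapping.lookup a w" by blast
  then have wa: "w \<in> Poly_Mapping.keys a" "w \<in> V" using a by (auto simp: in_keys_iff)
  show ?thesis
  proof (rule acyclic_at_cone[where w = w])
    fix F assume F: "F \<in> degree_faces a"
    then show "finite F" using finite_face by (simp add: degree_faces_def)
    have "Poly_Mapping.keys a \<union> insert w F = Poly_Mapping.keys a \<union> F" using wa by blast
    then show "insert w F \<in> degree_faces a" using F wa by (auto simp: degree_faces_def)
    have "independent_set E (Poly_Mapping.keys a \<union> F)" using F by (simp add: degree_faces_def)
    then have "independent_set E (Poly_Mapping.keys a \<union> (F - {w}))"
      by (rule independent_set_subset) blast
    then show "F - {w} \<in> degree_faces a" using F w by (auto simp: degree_faces_def)
  qed
next
  case False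
  define N where "N = Poly_Mapping.keys a"
  have neg: "{v. Poly_Mapping.lookup a v < 0} = N"
    unfolding N_def in_keys_iff set_eq_iff mem_Collect_eq using False by (metis less_irrefl linorder_neqE)
  have faces: "degree_faces a = {F. N \<subseteq> F \<and> F \<subseteq> V \<and> independent_set E F}"
    unfolding degree_faces_def neg N_def[symmetric] by (auto simp: Un_absorb1)
  show ?thesis
  proof (cases "independent_set E N")
    case True
    then show ?thesis
      unfolding faces using acyclic_at_independent_sets[OF simple nc d] a by (simp add: N_def)
  next
    case False
    then have "degree_faces a = {}"
      unfolding faces using independent_set_subset[of E _ N] by blast
    then show ?thesis by (auto simp: acyclic_at_def supported_on_def intro: exI[of _ "\<lambda>_. 0"])
  qed
qed

text \<open>
  Acyclicity gives the equation on the faces of degree \<open>a\<close>. It holds for all \<open>F\<close>: the cocycle vanishes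
  outside these faces, and if \<open>F\<close> fails to be one because it misses a vertex with negative exponent, then
  so do the sets \<open>F - {v}\<close>, on which \<open>b\<close> vanishes.
\<close>
lemma cocycle_bounds_degreewise:
  assumes nc: "\<nexists>p. graph_cycle V E p"
    and d: "\<And>F. maximal_independent_set V E F \<Longrightarrow> i < card F"
    and c: "c \<in> cocycles i" and a: "Poly_Mapping.keys a \<subseteq> V"
  shows "\<exists>b. supported_on (degree_faces a) b \<and> (\<forall>F\<in>faces i. coef c a i F =
      (coboundary b F when independent_set E (Poly_Mapping.keys a \<union> F)))"
proof -
  have cc: "c \<in> carrier (cochains i)" using c unfolding mem_cocycles by blast
  have "coboundary (coef c a i) H = 0" if "H \<in> degree_faces a" "card H = Suc i" for H
    using c that unfolding mem_cocycles degree_faces_def by blast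
  then obtain b where b: "supported_on (degree_faces a) b"
      "\<And>F. F \<in> degree_faces a \<Longrightarrow> card F = i \<Longrightarrow> coboundary b F = coef c a i F"
    using acyclic_atE[OF acyclic_at_degree_faces[OF nc d a] coef_supported[OF cc]] by blast
  have "coef c a i F = (coboundary b F when independent_set E (Poly_Mapping.keys a \<union> F))"
    if F: "F \<in> faces i" for F
  proof (cases "F \<in> degree_faces a")
    case True
    then show ?thesis using b(2)[of F] F by (simp add: degree_faces_def)
  next
    case False
    then have 0: "coef c a i F = 0" using coef_supported[OF cc] unfolding supported_on_def by blast
    have "coboundary b F = 0" if ind: "independent_set E (Poly_Mapping.keys a \<union> F)"
    proof -
      have "b (F - {v}) = 0" for v
        using False b(1) F ind unfolding supported_on_def degree_faces_def by blast
      then show ?thesis by (simp add: coboundary_def)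
    qed
    then show ?thesis using 0 by (simp add: when_def)
  qed
  then show ?thesis using b(1) by blast
qed

lemma cochain_of_coefs:
  assumes A: "finite A" "\<And>a. a \<in> A \<Longrightarrow> Poly_Mapping.keys a \<subseteq> V"
    and b: "\<And>a. a \<in> A \<Longrightarrow> supported_on (degree_faces a) (b a)"
  shows "\<exists>c\<in>carrier (cochains i). \<forall>F\<in>faces i. \<forall>a. coef c a i F = (b a F when a \<in> A)"
proof -
  define u where "u F = (\<Sum>a\<in>A. Poly_Mapping.single a (b a F))" for F
  have lookup_u: "Poly_Mapping.lookup (u F) a = (b a F when a \<in> A)" for F a
    using A(1) by (simp add: u_def lookup_sum lookup_single when_def)
  have "u F \<in> laurent_module F" for F
    unfolding laurent_module_def
  proof (intro CollectI ballI)
    fix a assume "a \<in> Poly_Mapping.keys (u F)"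
    then have a: "a \<in> A" "b a F \<noteq> 0" by (auto simp: in_keys_iff lookup_u)
    then have "F \<in> degree_faces a" using b unfolding supported_on_def by blast
    then show "Poly_Mapping.keys a \<subseteq> V \<and> independent_set E (Poly_Mapping.keys a \<union> F) \<and>
        (\<forall>v. Poly_Mapping.lookup a v < 0 \<longrightarrow> v \<in> F)"
      using A(2)[OF a(1)] unfolding degree_faces_def by blast
  qed
  then have u: "u F \<in> coord F ` carrier (loc F)" if "F \<in> faces i" for F
    using coord_image[of F] that by simp
  define f where "f F = inv_into (carrier (loc F)) (coord F) (u F)" for F
  have f: "f F \<in> carrier (loc F)" "coord F (f F) = u F" if "F \<in> faces i" for F
    unfolding f_def using inv_into_into[OF u[OF that]] f_inv_into_f[OF u[OF that]] by blast+
  show ?thesis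
  proof (intro bexI ballI allI)
    show "restrict f (faces i) \<in> carrier (cochains i)"
      unfolding carrier_cochains using f(1) by auto
    show "coef (restrict f (faces i)) a i F = (b a F when a \<in> A)" if "F \<in> faces i" for F a
      using f(2)[OF that] that lookup_u[of F a] unfolding coef_def by simp
  qed
qed

text \<open>
  A cochain involves only finitely many degrees \<open>a\<close>, so the primitives found in the single degrees are
  the components of a cochain.
\<close>
lemma cocycles_subset_coboundaries:
  assumes nc: "\<nexists>p. graph_cycle V E p"
    and d: "\<And>F. maximal_independent_set V E F \<Longrightarrow> i < card F"
  shows "cocycles i \<subseteq> coboundaries i"
proof
  fix c assume c: "c \<in> cocycles i"
  then have cc: "c \<in> carrier (cochains i)" unfolding mem_cocycles by blast
  define A where "A = (\<Union>F\<in>faces i. Poly_Mapping.keys (coord F (c F)))"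
  have A: "finite A" unfolding A_def using finite_V by auto
  have AV: "Poly_Mapping.keys a \<subseteq> V" if "a \<in> A" for a
    using that coord_in_laurent_module[OF cc] unfolding A_def laurent_module_def by blast
  have notA: "coef c a i F = 0" if "a \<notin> A" for a F
    using that by (auto simp: A_def coef_def in_keys_iff)
  obtain b where b: "\<And>a. a \<in> A \<Longrightarrow> supported_on (degree_faces a) (b a)"
    "\<And>a F. a \<in> A \<Longrightarrow> F \<in> faces i \<Longrightarrow> coef c a i F =
      (coboundary (b a) F when independent_set E (Poly_Mapping.keys a \<union> F))"
  proof -
    have "\<forall>a\<in>A. \<exists>b. supported_on (degree_faces a) b \<and> (\<forall>F\<in>faces i. coef c a i F =
        (coboundary b F when independent_set E (Poly_Mapping.keys a \<union> F)))"
      by (intro ballI cocycle_bounds_degreewise[OF nc d c AV])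
    from bchoice[OF this] show thesis using that by blast
  qed
  show "c \<in> coboundaries i"
  proof (cases i)
    case 0
    have "c = \<one>\<^bsub>cochains i\<^esub>"
    proof (rule cochain_eqI_coef[OF cc one_cochains_closed])
      fix F a assume F: "F \<in> faces i"
      then have "F = {}" using 0 finite_face by auto
      then have "coboundary (b a) F = 0" by (simp add: coboundary_def)
      then have "coef c a i F = 0" using b(2)[OF _ F] notA by (cases "a \<in> A") simp_all
      then show "coef c a i F = coef \<one>\<^bsub>cochains i\<^esub> a i F" by (simp only: coef_one)
    qed
    then show ?thesis using 0 by (simp add: cech_coboundaries_def)
  next
    case (Suc j)
    obtain e where e: "e \<in> carrier (cochains j)"
      "\<And>F a. F \<in> faces j \<Longrightarrow> coef e a j F = (b a F when a \<in> A)"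
      using cochain_of_coefs[OF A AV b(1)] by blast
    have "c = diff j e"
    proof (rule cochain_eqI_coef[OF cc])
      show "diff j e \<in> carrier (cochains i)" using diff_closed[OF e(1)] Suc by simp
      fix F a assume F: "F \<in> faces i"
      have "coboundary (coef e a j) F = (coboundary (b a) F when a \<in> A)"
      proof -
        have "coef e a j (F - {v}) = (b a (F - {v}) when a \<in> A)" if "v \<in> F" for v
          using F Suc that finite_face by (intro e(2)) auto
        then show ?thesis by (simp add: coboundary_def when_def)
      qed
      then have "coef (diff j e) a i F = coef c a i F"
        using coef_diff[OF e(1), of F a] F Suc b(2)[OF _ F, of a] notA[of a F]
        by (cases "a \<in> A") simp_all
      then show "coef c a i F = coef (diff j e) a i F" ..
    qed
    then show ?thesis using Suc e(1) by (simp add: cech_coboundaries_def)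
  qed
qed

text \<open>
  The cochain \<open>c\<close> has the single component \<open>1 / (\<Prod>v\<in>A. x\<^sub>v)\<close> at \<open>A\<close>. It is a cocycle since no proper
  superset of \<open>A\<close> is independent. It is no coboundary since the component of any cochain at \<open>A - {v}\<close> has
  no terms with negative exponent at \<open>v\<close>.
\<close>
lemma cocycles_not_subset_coboundaries:
  assumes A: "maximal_independent_set V E A"
  shows "\<not> cocycles (card A) \<subseteq> coboundaries (card A)"
proof
  assume sub: "cocycles (card A) \<subseteq> coboundaries (card A)"
  define a where "a = face_exponent A (- 1)"
  have AV: "A \<subseteq> V" and ind: "independent_set E A"
    using A by (auto simp: maximal_independent_set_def)
  have fin: "finite A" using AV by (rule finite_face)
  have keys_a: "Poly_Mapping.keys a = A" and neg_a: "{v. Poly_Mapping.lookup a v < 0} = A"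
    using fin by (auto simp: a_def in_keys_iff split: if_splits)
  define b :: "'v set \<Rightarrow> 'k" where "b F = (if F = A then 1 else 0)" for F
  have supp: "supported_on (degree_faces a) b"
    unfolding supported_on_def degree_faces_def b_def keys_a neg_a using AV ind by simp
  have "finite {a}" by simp
  moreover have "Poly_Mapping.keys a' \<subseteq> V" "supported_on (degree_faces a') b" if "a' \<in> {a}" for a'
    using that keys_a AV supp by simp_all
  ultimately have "\<exists>c\<in>carrier (cochains (card A)). \<forall>F\<in>faces (card A). \<forall>a'.
      coef c a' (card A) F = (b F when a' \<in> {a})"
    by (rule cochain_of_coefs)
  then obtain c where c: "c \<in> carrier (cochains (card A))"
    "\<And>F a'. F \<in> faces (card A) \<Longrightarrow> coef c a' (card A) F = (b F when a' \<in> {a})"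
    by blast
  have "coboundary (coef c a' (card A)) G = 0"
    if G: "G \<in> faces (Suc (card A))" "independent_set E (Poly_Mapping.keys a' \<union> G)" for G a'
  proof -
    have "coef c a' (card A) (G - {v}) = 0" if v: "v \<in> G" for v
    proof -
      have "G - {v} \<in> faces (card A)" using G v finite_face by auto
      moreover have "G - {v} \<noteq> A"
      proof
        assume "G - {v} = A"
        then have "G = insert v A" "v \<in> V - A" using v G by auto
        moreover have "independent_set E G" using G(2) by (rule independent_set_subset) blast
        ultimately show False using A unfolding maximal_independent_set_def by blast
      qed
      ultimately show ?thesis using c(2) by (simp add: b_def)
    qed
    then show ?thesis by (simp add: coboundary_def)
  qed
  then have "c \<in> cocycles (card A)" unfolding mem_cocycles using c(1) by blast
  then have cb: "c \<in> coboundaries (card A)" using sub by blast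
  have coef1: "coef c a (card A) A = 1" using c(2)[of A a] AV by (simp add: b_def)
  show False
  proof (cases "card A")
    case 0
    then have "c = \<one>\<^bsub>cochains (card A)\<^esub>" using cb by (simp add: cech_coboundaries_def)
    then show False using coef1 coef_one[of "card A" a A] by simp
  next
    case (Suc j)
    then obtain e where e: "e \<in> carrier (cochains j)" "c = diff j e"
      using cb by (auto simp: cech_coboundaries_def)
    have "coef e a j (A - {v}) = 0" if "v \<in> A" for v
      using coef_supported[OF e(1), of a] that neg_a unfolding supported_on_def degree_faces_def by blast
    then have "coboundary (coef e a j) A = 0" by (simp add: coboundary_def)
    moreover have "A \<in> faces (Suc j)" using AV Suc by simp
    ultimately have "coef c a (Suc j) A = 0" unfolding e(2) by (simp only: coef_diff[OF e(1)] when_def if_cancel)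
    then show False using coef1 Suc by simp
  qed
qed

text \<open>
  Since a finite graph has a maximal independent set of least size, this determines the depth for all
  forests.
\<close>
theorem depth_edge_ideal_forest:
  assumes nc: "\<nexists>p. graph_cycle V E p"
    and A: "maximal_independent_set V E A"
    and minimal: "\<And>F. maximal_independent_set V E F \<Longrightarrow> card A \<le> card F"
  shows "depth R mvar V M = card A"
  unfolding depth_def local_cohomology_trivial_iff
proof (rule Least_equality)
  show "\<not> cocycles (card A) \<subseteq> coboundaries (card A)"
    using A by (rule cocycles_not_subset_coboundaries)
  show "card A \<le> i" if "\<not> cocycles i \<subseteq> coboundaries i" for i
  proof (rule ccontr)
    assume "\<not> card A \<le> i"
    then have "i < card F" if "maximal_independent_set V E F" for F
      using minimal[OF that] by simp
    then have "cocycles i \<subseteq> coboundaries i" by (intro cocycles_subset_coboundaries[OF nc])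
    then show False using that by blast
  qed
qed

end

section \<open>The depth of the quotient by the edge ideal of a perfect binary tree\<close>

theorem proposition4p2:
  fixes n h m :: nat and E :: "nat set set"
  assumes "perfect_binary_tree {1..n} E h" and "h > 0"
  shows "let S = (poly_ring {1..n} :: ((nat \<Rightarrow>\<^sub>0 nat) \<Rightarrow>\<^sub>0 'k::field) ring);
             I = edge_ideal {1..n} E;
             d = real (depth S mvar {1..n} (quotient_module S I))
         in (h = 3 * m \<longrightarrow> d = (4 * 8 ^ m + 3) / 7) \<and>
            (h = 3 * m + 1 \<longrightarrow> d = (8 ^ (m + 1) - 1) / 7) \<and>
            (h = 3 * m + 2 \<longrightarrow> d = 2 * (8 ^ (m + 1) - 1) / 7)"
proof -
  obtain r where r: "tree {1..n} E" "r \<in> {1..n}"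
    "\<forall>v\<in>{1..n}. (children {1..n} E r v \<noteq> {} \<longrightarrow> card (children {1..n} E r v) = 2) \<and>
       (children {1..n} E r v = {} \<longrightarrow> graph_dist {1..n} E r v = h)"
    using assms(1) unfolding perfect_binary_tree_def by blast
  interpret T: perfect_binary_rooted_tree "{1..n}" E r h
    using r by unfold_locales blast+
  interpret Q: edge_ideal_quotient "{1..n}" E "TYPE('k)"
    by unfold_locales (rule T.simple)
  let ?d = "depth (poly_ring {1..n} :: ((nat \<Rightarrow>\<^sub>0 nat) \<Rightarrow>\<^sub>0 'k) ring) mvar {1..n}
      (quotient_module (poly_ring {1..n}) (edge_ideal {1..n} E))"
  have d: "?d = card T.sparse_levels"
    using T.no_cycle T.sparse_levels_maximal_independent T.card_maximal_independent_ge
    by (rule Q.depth_edge_ideal_forest)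
  have "real ?d = (4 * 8 ^ m + 3) / 7" if "h = 3 * m"
  proof -
    have "real (7 * ?d) = real (4 * 8 ^ m + 3)"
      unfolding d using T.card_sparse_levels_0[OF that] by (simp only:)
    then show ?thesis by simp
  qed
  moreover have "real ?d = (8 ^ (m + 1) - 1) / 7" if "h = 3 * m + 1"
  proof -
    have "real (7 * ?d + 1) = real (8 ^ (m + 1))"
      unfolding d using T.card_sparse_levels_1[OF that] by (simp only:)
    then show ?thesis by simp
  qed
  moreover have "real ?d = 2 * (8 ^ (m + 1) - 1) / 7" if "h = 3 * m + 2"
  proof -
    have "real (7 * ?d + 2) = real (2 * 8 ^ (m + 1))"
      unfolding d using T.card_sparse_levels_2[OF that] by (simp only:)
    then show ?thesis by simp
  qed
  ultimately show ?thesis by (simp only: Let_def) blast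
qed

end
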